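(* Set $C:=\begin{bmatrix}0&1\\1&1\end{bmatrix}\in\mathrm{M}_2(\mathbb{F}_2)$. Up to similarity, there are three reducible $3$-dimensional trivial spectrum linear subspaces of $\mathrm{M}_3(\mathbb{F}_2)$: $$\mathbb{F}_2C\vee\{0\},\quad \{0\}\vee\mathbb{F}_2C\quad\text{and}\quad \mathrm{NT}_3(\mathbb{F}_2).$$
   Context: Two linear subspaces $\mathcal{V}_1,\mathcal{V}_2$ of $\mathrm{M}_n(\mathbb{K})$ are similar when $\mathcal{V}_2=P\mathcal{V}_1P^{-1}$ for some $P\in\mathrm{GL}_n(\mathbb{K})$. A linear subspace $\mathcal{V}$ of $\mathrm{M}_n(\mathbb{K})$ has a trivial spectrum when no matrix of $\mathcal{V}$ has an eigenvalue in $\mathbb{K}\setminus\{0\}$. A trivial spectrum subspace $\mathcal{V}$ of $\mathrm{M}_n(\mathbb{K})$ is irreducible when there is no proper non-zero linear subspace $F$ of $\mathbb{K}^n$ such that $\mathcal{V}X\subset F$ for all $X\in F$, where $\mathcal{V}X=\{MX\mid M\in\mathcal{V}\}$; otherwise it is reducible. $\mathrm{NT}_3(\mathbb{F}_2)$ is the space of all strictly upper-triangular $3\times3$ matrices over $\mathbb{F}_2$. For linear subspaces $\mathcal{A}$ of $\mathrm{M}_n(\mathbb{K})$ and $\mathcal{B}$ of $\mathrm{M}_p(\mathbb{K})$, $\mathcal{A}\vee\mathcal{B}$ is the space of all matrices $\begin{bmatrix}A&D\\ [0]_{p\times n}&B\end{bmatrix}$ with $A\in\mathcal{A}$, $B\in\mathcal{B}$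 and $D\in\mathrm{M}_{n,p}(\mathbb{K})$. In the claim, $\mathbb{F}_2C$ is the linear span of $C$ in $\mathrm{M}_2(\mathbb{F}_2)$ and $\{0\}$ is the zero subspace of $\mathrm{M}_1(\mathbb{F}_2)$. *)

theory Defs
  imports
    "HOL-Library.Z2"
    "Jordan_Normal_Form.VS_Connect"
    "Jordan_Normal_Form.Char_Poly"
begin

definition mat_subspace :: "nat \<Rightarrow> 'a::field mat set \<Rightarrow> bool" where
  "mat_subspace n \<V> \<longleftrightarrow> VectorSpace.subspace class_ring \<V> (module_mat TYPE('a) n n)"

definition vec_subspace :: "nat \<Rightarrow> 'a::field vec set \<Rightarrow> bool" where
  "vec_subspace n F \<longleftrightarrow> VectorSpace.subspace class_ring F (module_vec TYPE('a) n)"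

definition mat_subspace_dim :: "nat \<Rightarrow> 'a::field mat set \<Rightarrow> nat" where
  "mat_subspace_dim n \<V> =
     vectorspace.dim class_ring ((module_mat TYPE('a) n n)\<lparr>carrier := \<V>\<rparr>)"

definition mat_span :: "nat \<Rightarrow> 'a::field mat set \<Rightarrow> 'a mat set" where
  "mat_span n S = LinearCombinations.module.span class_ring (module_mat TYPE('a) n n) S"

(* Q is the inverse of P. *)
definition similar_mat_spaces :: "nat \<Rightarrow> 'a::field mat set \<Rightarrow> 'a mat set \<Rightarrow> bool" where
  "similar_mat_spaces n \<V>1 \<V>2 \<longleftrightarrow>
     (\<exists>P \<in> carrier_mat n n. \<exists>Q \<in> carrier_mat n n.
        P * Q = 1\<^sub>m n \<and> Q * P = 1\<^sub>m n \<and> \<V>2 = (\<lambda>M. P * M * Q) ` \<V>1)"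

definition trivial_spectrum_subspace :: "nat \<Rightarrow> 'a::field mat set \<Rightarrow> bool" where
  "trivial_spectrum_subspace n \<V> \<longleftrightarrow>
     mat_subspace n \<V> \<and> (\<forall>M \<in> \<V>. \<not> (\<exists>k. k \<noteq> 0 \<and> eigenvalue M k))"

definition irreducible_mat_space :: "nat \<Rightarrow> 'a::field mat set \<Rightarrow> bool" where
  "irreducible_mat_space n \<V> \<longleftrightarrow>
     \<not> (\<exists>F. vec_subspace n F \<and> F \<noteq> {0\<^sub>v n} \<and> F \<noteq> carrier_vec n \<and>
          (\<forall>X \<in> F. {M *\<^sub>v X | M. M \<in> \<V>} \<subseteq> F))"

definition strict_upper_triangular_mats :: "nat \<Rightarrow> 'a::field mat set" where
  "strict_upper_triangular_mats n =
     {M \<in> carrier_mat n n. \<forall>i < n. \<forall>j \<le> i. M $$ (i, j) = 0}"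

definition mat_space_join ::
    "nat \<Rightarrow> nat \<Rightarrow> 'a::field mat set \<Rightarrow> 'a mat set \<Rightarrow> 'a mat set" where
  "mat_space_join n p \<A> \<B> =
     {four_block_mat A D (0\<^sub>m p n) B | A B D. A \<in> \<A> \<and> B \<in> \<B> \<and> D \<in> carrier_mat n p}"

definition C_mat :: "bit mat" where
  "C_mat = mat_of_rows_list 2 [[0, 1], [1, 1]]"

end

theory Submission
  imports Defs "Jordan_Normal_Form.Schur_Decomposition" "Jordan_Normal_Form.DL_Rank"
begin

text \<open>
  The field has two elements, so a subspace has trivial spectrum as soon as 1 is not an eigenvalue of
  any of its matrices, and it has dimension 3 exactly if it has 8 elements
  (\<open>card_eq_2_power_mat_subspace_dim\<close>).

  Reducibility provides an invariant line or an invariant plane. On an invariant line every matrix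
  acts by an eigenvalue, which must be 0; a plane is the kernel of a linear form, which spans an
  invariant line of the transposed space. Hence the space or its transpose has a common null vector
  (\<open>reducible_imp_common_kernel_vector\<close>).

  Suppose that the space itself has one. With this vector as first basis vector all matrices have zero
  first column, and the lower right 2 by 2 corners form a trivial spectrum space \<open>\<K>\<close>. Such a \<open>\<K>\<close> has at
  most one nonzero element (\<open>trivial_spectrum_bit_2_eq\<close>), so the count of 8 leaves no choice: the space
  is \<open>{0} \<or> \<K>\<close> with \<open>\<K>\<close> a line. A generator of \<open>\<K>\<close> has equal trace and determinant \<open>t\<close>, so it is
  similar to the companion matrix of \<open>X\<^sup>2 + t X + t\<close> (\<open>similar_companion_mat\<close>). This matrix is \<open>C\<close> for
  \<open>t = 1\<close> and the nilpotent Jordan block for \<open>t = 0\<close>, which yields \<open>{0} \<or> F\<^sub>2 C\<close> and the strictly upper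
  triangular matrices.

  If the transposed space has the null vector, the same applies to the transpose. Since the transpose
  of \<open>\<A> \<or> \<B>\<close> is similar to the join of the transposes in the opposite order
  (\<open>similar_mat_spaces_transpose_join\<close>), one finds \<open>F\<^sub>2 C \<or> {0}\<close> or, again, the strictly upper
  triangular matrices.

  The three classes are distinguished by common null vectors on the two sides: \<open>{0} \<or> F\<^sub>2 C\<close> has one
  on the right only, \<open>F\<^sub>2 C \<or> {0}\<close> on the left only, and the strictly upper triangular matrices have
  them on both sides.
\<close>

section \<open>Subspaces and counting\<close>

lemma mat_subspace_iff:
  fixes \<V> :: "'a::field mat set"
  shows "mat_subspace n \<V> \<longleftrightarrow> \<V> \<subseteq> carrier_mat n n \<and> 0\<^sub>m n n \<in> \<V> \<and>
     (\<forall>A\<in>\<V>. \<forall>B\<in>\<V>. A + B \<in> \<V>) \<and> (\<forall>c. \<forall>A\<in>\<V>. c \<cdot>\<^sub>m A \<in> \<V>)"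
proof -
  have "Module.module class_ring (module_mat TYPE('a) n n)"
    using matrix_vs[where 'a = 'a, of n n] by (simp add: vectorspace_def)
  then show ?thesis
    unfolding mat_subspace_def VectorSpace.subspace_def submodule_def
    using matrix_vs[where 'a = 'a, of n n] by (auto simp: module_mat_simps)
qed

lemma vec_subspace_iff:
  fixes F :: "'a::field vec set"
  shows "vec_subspace n F \<longleftrightarrow> F \<subseteq> carrier_vec n \<and> 0\<^sub>v n \<in> F \<and>
     (\<forall>x\<in>F. \<forall>y\<in>F. x + y \<in> F) \<and> (\<forall>c. \<forall>x\<in>F. c \<cdot>\<^sub>v x \<in> F)"
  unfolding vec_subspace_def VectorSpace.subspace_def submodule_def
  using vec_vs[where 'a = 'a, of n] vec_module[where 'a = 'a, of n] by (auto simp: module_vec_simps)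

text \<open>Taking coordinates with respect to a basis is a bijection from the space onto the functions from
  the basis to the field.\<close>

lemma (in vectorspace) card_carrier_eq_card_field_power_dim:
  assumes fin: "finite (carrier V)"
  shows "card (carrier V) = card (carrier K) ^ dim"
proof -
  have "fin_dim"
    unfolding fin_dim_def
    using fin span_is_subset2[of "carrier V"] in_own_span[of "carrier V"] by auto
  then obtain B where B: "finite B" "basis B"
    using finite_basis_exists by blast
  then have BV: "B \<subseteq> carrier V"
    by (simp add: basis_def)
  have uniq: "\<exists>!a. a \<in> B \<rightarrow>\<^sub>E carrier K \<and> lincomb a B = v" if "v \<in> carrier V" for v
    using basis_criterion[OF B(1) BV] B(2) that by blast
  have in_V: "lincomb a B \<in> carrier V" if "a \<in> B \<rightarrow>\<^sub>E carrier K" for a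
    using that BV by (intro lincomb_closed) (auto simp: PiE_def)
  have "bij_betw (\<lambda>a. lincomb a B) (B \<rightarrow>\<^sub>E carrier K) (carrier V)"
    unfolding bij_betw_def inj_on_def using uniq in_V by (auto simp: image_iff) metis+
  then have "card (carrier V) = card (B \<rightarrow>\<^sub>E carrier K)"
    by (simp add: bij_betw_same_card)
  also have "\<dots> = card (carrier K) ^ card B"
    using B(1) by (simp add: card_PiE)
  finally show ?thesis
    using dim_basis[OF B] by simp
qed

lemma finite_card_carrier_mat:
  assumes fin: "finite (UNIV :: 'a set)"
  shows "finite (carrier_mat nr nc :: 'a mat set)"
    and "card (carrier_mat nr nc :: 'a mat set) = card (UNIV :: 'a set) ^ (nr * nc)"
proof -
  let ?I = "{..<nr} \<times> {..<nc}"
  let ?F = "?I \<rightarrow>\<^sub>E (UNIV :: 'a set)"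
  have bij: "bij_betw (mat nr nc) ?F (carrier_mat nr nc :: 'a mat set)"
  proof (rule bij_betwI')
    fix f g assume fg: "f \<in> ?F" "g \<in> ?F"
    show "mat nr nc f = mat nr nc g \<longleftrightarrow> f = g"
    proof
      assume eq: "mat nr nc f = mat nr nc g"
      show "f = g"
      proof (rule PiE_ext[OF fg])
        fix ij assume "ij \<in> ?I"
        then show "f ij = g ij"
          using arg_cong[OF eq, of "\<lambda>M. M $$ ij"] by auto
      qed
    qed simp
  next
    fix A :: "'a mat" assume "A \<in> carrier_mat nr nc"
    then have "A = mat nr nc (restrict (($$) A) ?I)"
      by (intro eq_matI) auto
    then show "\<exists>f \<in> ?F. A = mat nr nc f"
      by (metis restrict_PiE_iff UNIV_I)
  qed auto
  have "finite ?F"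
    using fin by (intro finite_PiE) auto
  then show "finite (carrier_mat nr nc :: 'a mat set)"
    using bij_betw_finite[OF bij] by simp
  have "card ?F = card (UNIV :: 'a set) ^ (nr * nc)"
    by (simp add: card_PiE)
  then show "card (carrier_mat nr nc :: 'a mat set) = card (UNIV :: 'a set) ^ (nr * nc)"
    using bij_betw_same_card[OF bij] by simp
qed

lemma UNIV_bit: "(UNIV :: bit set) = {0, 1}"
  using bit_not_zero_iff by blast

lemma finite_UNIV_bit: "finite (UNIV :: bit set)"
  by (simp add: UNIV_bit)

lemma card_UNIV_bit: "card (UNIV :: bit set) = 2"
  by (simp add: UNIV_bit)

text \<open>Counting replaces dimension theory over \<open>F\<^sub>2\<close>: to have dimension 3 is to have 8 elements.\<close>

lemma card_eq_2_power_mat_subspace_dim: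
  fixes \<V> :: "bit mat set"
  assumes "mat_subspace n \<V>"
  shows "card \<V> = 2 ^ mat_subspace_dim n \<V>"
proof -
  let ?M = "module_mat TYPE(bit) n n"
  have sub: "VectorSpace.subspace class_ring \<V> ?M"
    using assms by (simp add: mat_subspace_def)
  interpret W: vectorspace class_ring "?M\<lparr>carrier := \<V>\<rparr>"
    by (rule vectorspace.subspace_is_vs[OF matrix_vs sub])
  have "finite \<V>"
    using assms finite_card_carrier_mat(1)[OF finite_UNIV_bit]
    by (auto simp: mat_subspace_iff intro: finite_subset)
  then show ?thesis
    using W.card_carrier_eq_card_field_power_dim
    by (simp add: mat_subspace_dim_def card_UNIV_bit)
qed

lemma mat_span_singleton:
  fixes C :: "'a::field mat"
  assumes C: "C \<in> carrier_mat n n"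
  shows "mat_span n {C} = range (\<lambda>c. c \<cdot>\<^sub>m C)"
proof -
  interpret M: vectorspace class_ring "module_mat TYPE('a) n n"
    by (rule matrix_vs)
  have lc: "M.lincomb a {C} = a C \<cdot>\<^sub>m C" for a
    using C by (simp add: M.lincomb_def module_mat_simps M.finsum_insert Pi_def
        right_add_zero_mat[of "a C \<cdot>\<^sub>m C" n n])
  have "M.span {C} = {M.lincomb a {C} | a. a \<in> {C} \<rightarrow> UNIV}"
    using C by (subst M.finite_span) (auto simp: module_mat_simps)
  also have "\<dots> = range (\<lambda>c. c \<cdot>\<^sub>m C)"
    unfolding lc by (auto intro!: exI[of _ "\<lambda>_. _"])
  finally show ?thesis
    by (simp add: mat_span_def)
qed

section \<open>Similarity of matrix spaces\<close>

lemma conj_mat_comp: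
  fixes M :: "'a::semiring_1 mat"
  assumes "P1 \<in> carrier_mat n n" "Q1 \<in> carrier_mat n n" "P2 \<in> carrier_mat n n"
    "Q2 \<in> carrier_mat n n" "M \<in> carrier_mat n n"
  shows "P2 * (P1 * M * Q1) * Q2 = (P2 * P1) * M * (Q1 * Q2)"
  using assms by (simp add: assoc_mult_mat[of _ n n _ n _ n])

lemma conj_mat_cancel:
  fixes M :: "'a::semiring_1 mat"
  assumes "P \<in> carrier_mat n n" "Q \<in> carrier_mat n n" "Q * P = 1\<^sub>m n" "M \<in> carrier_mat n n"
  shows "Q * (P * M * Q) * P = M"
  using assms conj_mat_comp[of P n Q Q P M] by (simp del: assoc_mult_mat)

lemma conj_mat_mult_vec:
  fixes M :: "'a::semiring_1 mat"
  assumes "P \<in> carrier_mat n n" "Q \<in> carrier_mat n n" "Q * P = 1\<^sub>m n" "M \<in> carrier_mat n n"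
    "x \<in> carrier_vec n"
  shows "(P * M * Q) *\<^sub>v (P *\<^sub>v x) = P *\<^sub>v (M *\<^sub>v x)"
proof -
  have "(P * M * Q) *\<^sub>v (P *\<^sub>v x) = P *\<^sub>v (M *\<^sub>v ((Q * P) *\<^sub>v x))"
    using assms(1,2,4,5) by (simp add: assoc_mult_mat_vec[of _ n n _ n])
  then show ?thesis
    using assms by simp
qed

lemma similar_mat_spacesI:
  assumes "P \<in> carrier_mat n n" "Q \<in> carrier_mat n n" "P * Q = 1\<^sub>m n" "Q * P = 1\<^sub>m n"
    and "\<W> = (\<lambda>M. P * M * Q) ` \<V>"
  shows "similar_mat_spaces n \<V> \<W>"
  using assms unfolding similar_mat_spaces_def by blast

lemma similar_mat_spacesE:
  assumes "similar_mat_spaces n \<V> \<W>"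
  obtains P Q where "P \<in> carrier_mat n n" "Q \<in> carrier_mat n n" "P * Q = 1\<^sub>m n"
    "Q * P = 1\<^sub>m n" "\<W> = (\<lambda>M. P * M * Q) ` \<V>"
  using assms unfolding similar_mat_spaces_def by blast

lemma similar_mat_spaces_carrier:
  assumes "similar_mat_spaces n \<V> \<W>" "\<V> \<subseteq> carrier_mat n n"
  shows "\<W> \<subseteq> carrier_mat n n"
  using assms by (elim similar_mat_spacesE) (auto intro!: mult_carrier_mat)

lemma similar_mat_spaces_refl:
  assumes "\<V> \<subseteq> carrier_mat n n"
  shows "similar_mat_spaces n \<V> \<V>"
proof (rule similar_mat_spacesI[of "1\<^sub>m n" n "1\<^sub>m n"])
  have "1\<^sub>m n * M * 1\<^sub>m n = M" if "M \<in> \<V>" for M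
    using that assms by auto
  then show "\<V> = (\<lambda>M. 1\<^sub>m n * M * 1\<^sub>m n) ` \<V>"
    by simp
qed auto

lemma similar_mat_spaces_sym:
  assumes "similar_mat_spaces n \<V> \<W>" "\<V> \<subseteq> carrier_mat n n"
  shows "similar_mat_spaces n \<W> \<V>"
proof -
  obtain P Q where PQ: "P \<in> carrier_mat n n" "Q \<in> carrier_mat n n" "P * Q = 1\<^sub>m n"
    "Q * P = 1\<^sub>m n" and W: "\<W> = (\<lambda>M. P * M * Q) ` \<V>"
    using assms(1) by (rule similar_mat_spacesE)
  have "Q * (P * M * Q) * P = M" if "M \<in> \<V>" for M
    using conj_mat_cancel[OF PQ(1,2,4)] that assms(2) by blast
  then have "\<V> = (\<lambda>M. Q * M * P) ` \<W>"
    by (simp add: W image_image)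
  then show ?thesis
    by (rule similar_mat_spacesI[OF PQ(2,1,4,3)])
qed

lemma similar_mat_spaces_trans:
  assumes "similar_mat_spaces n \<U> \<V>" "similar_mat_spaces n \<V> \<W>" "\<U> \<subseteq> carrier_mat n n"
  shows "similar_mat_spaces n \<U> \<W>"
proof -
  obtain P Q where PQ: "P \<in> carrier_mat n n" "Q \<in> carrier_mat n n" "P * Q = 1\<^sub>m n"
    "Q * P = 1\<^sub>m n" and V: "\<V> = (\<lambda>M. P * M * Q) ` \<U>"
    using assms(1) by (rule similar_mat_spacesE)
  obtain R S where RS: "R \<in> carrier_mat n n" "S \<in> carrier_mat n n" "R * S = 1\<^sub>m n"
    "S * R = 1\<^sub>m n" and W: "\<W> = (\<lambda>M. R * M * S) ` \<V>"
    using assms(2) by (rule similar_mat_spacesE)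
  show ?thesis
  proof (rule similar_mat_spacesI[of "R * P" n "Q * S"])
    have "R * P * (Q * S) = R * (P * Q) * S" "Q * S * (R * P) = Q * (S * R) * P"
      using PQ(1,2) RS(1,2) by (simp_all add: assoc_mult_mat[of _ n n _ n _ n])
    then show "R * P * (Q * S) = 1\<^sub>m n" "Q * S * (R * P) = 1\<^sub>m n"
      using PQ RS by simp_all
    have "R * (P * M * Q) * S = R * P * M * (Q * S)" if "M \<in> \<U>" for M
      using conj_mat_comp[OF PQ(1,2) RS(1,2)] that assms(3) by blast
    then show "\<W> = (\<lambda>M. R * P * M * (Q * S)) ` \<U>"
      by (simp add: V W image_image)
  qed (use PQ RS in auto)
qed

text \<open>Transposition turns conjugation by \<open>P\<close> into conjugation by the inverse transpose of \<open>P\<close>, so that every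
  statement about right kernels has a mirror image about left kernels.\<close>

lemma similar_mat_spaces_transpose:
  fixes \<V> :: "'a::field mat set"
  assumes "similar_mat_spaces n \<V> \<W>" "\<V> \<subseteq> carrier_mat n n"
  shows "similar_mat_spaces n (transpose_mat ` \<V>) (transpose_mat ` \<W>)"
proof -
  obtain P Q where PQ: "P \<in> carrier_mat n n" "Q \<in> carrier_mat n n" "P * Q = 1\<^sub>m n"
    "Q * P = 1\<^sub>m n" and W: "\<W> = (\<lambda>M. P * M * Q) ` \<V>"
    using assms(1) by (rule similar_mat_spacesE)
  have "transpose_mat (P * M * Q) = transpose_mat Q * transpose_mat M * transpose_mat P"
    if "M \<in> \<V>" for M
  proof -
    have M: "M \<in> carrier_mat n n" using that assms(2) by blast
    show ?thesis
      using PQ(1,2) M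
      by (simp add: transpose_mult[of _ n n _ n] assoc_mult_mat[of _ n n _ n _ n])
  qed
  then have "transpose_mat ` \<W> =
      (\<lambda>M. transpose_mat Q * M * transpose_mat P) ` (transpose_mat ` \<V>)"
    by (simp add: W image_image)
  moreover have "transpose_mat Q * transpose_mat P = 1\<^sub>m n"
    using transpose_mult[OF PQ(1,2)] PQ(3) by simp
  moreover have "transpose_mat P * transpose_mat Q = 1\<^sub>m n"
    using transpose_mult[OF PQ(2,1)] PQ(4) by simp
  ultimately show ?thesis
    using PQ(1,2)
    by (intro similar_mat_spacesI[of "transpose_mat Q" n "transpose_mat P"]) auto
qed

lemma similar_mat_spaces_card:
  assumes "similar_mat_spaces n \<V> \<W>" "\<V> \<subseteq> carrier_mat n n"
  shows "card \<W> = card \<V>"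
proof -
  obtain P Q where PQ: "P \<in> carrier_mat n n" "Q \<in> carrier_mat n n" "P * Q = 1\<^sub>m n"
    "Q * P = 1\<^sub>m n" and W: "\<W> = (\<lambda>M. P * M * Q) ` \<V>"
    using assms(1) by (rule similar_mat_spacesE)
  have "inj_on (\<lambda>M. P * M * Q) \<V>"
    using conj_mat_cancel[OF PQ(1,2,4)] assms(2)
    by (intro inj_on_inverseI[of _ "\<lambda>M. Q * M * P"]) auto
  then show ?thesis
    by (simp add: W card_image)
qed

lemma similar_mat_spaces_mat_subspace:
  fixes \<V> :: "'a::field mat set"
  assumes "similar_mat_spaces n \<V> \<W>" "mat_subspace n \<V>"
  shows "mat_subspace n \<W>"
proof -
  obtain P Q where PQ: "P \<in> carrier_mat n n" "Q \<in> carrier_mat n n" "P * Q = 1\<^sub>m n"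
    "Q * P = 1\<^sub>m n" and W: "\<W> = (\<lambda>M. P * M * Q) ` \<V>"
    using assms(1) by (rule similar_mat_spacesE)
  have V: "\<V> \<subseteq> carrier_mat n n" "0\<^sub>m n n \<in> \<V>" "\<And>A B. A \<in> \<V> \<Longrightarrow> B \<in> \<V> \<Longrightarrow> A + B \<in> \<V>"
    "\<And>c A. A \<in> \<V> \<Longrightarrow> c \<cdot>\<^sub>m A \<in> \<V>"
    using assms(2) by (auto simp: mat_subspace_iff)
  have "P * 0\<^sub>m n n * Q = 0\<^sub>m n n"
    using PQ(1,2) by simp
  then have "0\<^sub>m n n \<in> \<W>"
    using V(2) unfolding W by (metis imageI)
  moreover have "A + B \<in> \<W>" if AB: "A \<in> \<W>" "B \<in> \<W>" for A B
  proof -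
    obtain M N where MN: "M \<in> \<V>" "N \<in> \<V>" "A = P * M * Q" "B = P * N * Q"
      using AB unfolding W by blast
    then have eq: "P * (M + N) * Q = A + B"
      using PQ(1,2) V(1)
      by (simp add: subset_iff mult_add_distrib_mat[of _ n n _ n]
          add_mult_distrib_mat[of _ n n _ _ n])
    have "P * (M + N) * Q \<in> \<W>"
      unfolding W using MN V(3) by blast
    then show ?thesis
      by (simp only: eq)
  qed
  moreover have "c \<cdot>\<^sub>m A \<in> \<W>" if A: "A \<in> \<W>" for c A
  proof -
    obtain M where M: "M \<in> \<V>" "A = P * M * Q"
      using A unfolding W by blast
    then have eq: "P * (c \<cdot>\<^sub>m M) * Q = c \<cdot>\<^sub>m A"
      using PQ(1,2) V(1)
      by (auto simp: mult_smult_distrib[of _ n n] mult_smult_assoc_mat[of _ n n])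
    have "P * (c \<cdot>\<^sub>m M) * Q \<in> \<W>"
      unfolding W using M V(4) by blast
    then show ?thesis
      by (simp only: eq)
  qed
  ultimately show ?thesis
    using similar_mat_spaces_carrier[OF assms(1) V(1)] by (simp add: mat_subspace_iff)
qed

lemma similar_mat_spaces_trivial_spectrum:
  fixes \<V> :: "'a::field mat set"
  assumes "similar_mat_spaces n \<V> \<W>" "trivial_spectrum_subspace n \<V>"
  shows "trivial_spectrum_subspace n \<W>"
proof -
  have sub: "mat_subspace n \<V>"
    using assms(2) by (simp add: trivial_spectrum_subspace_def)
  have V: "\<V> \<subseteq> carrier_mat n n"
    using sub by (simp add: mat_subspace_iff)
  obtain P Q where PQ: "P \<in> carrier_mat n n" "Q \<in> carrier_mat n n" "P * Q = 1\<^sub>m n"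
    "Q * P = 1\<^sub>m n" and W: "\<W> = (\<lambda>M. P * M * Q) ` \<V>"
    using assms(1) by (rule similar_mat_spacesE)
  have "eigenvalue (P * M * Q) k \<longleftrightarrow> eigenvalue M k" if "M \<in> \<V>" for M k
  proof -
    have M: "M \<in> carrier_mat n n"
      using V that by blast
    have "similar_mat (P * M * Q) M"
      using PQ M by (intro similar_matI[of _ _ P Q n]) auto
    moreover have "P * M * Q \<in> carrier_mat n n"
      using PQ(1,2) M by (intro mult_carrier_mat)
    ultimately show ?thesis
      using M by (simp only: char_poly_similar eigenvalue_root_char_poly)
  qed
  then show ?thesis
    using assms similar_mat_spaces_mat_subspace[OF assms(1) sub]
    by (auto simp: trivial_spectrum_subspace_def W)
qed

lemma trivial_spectrum_subspace_transpose:
  fixes \<V> :: "'a::field mat set"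
  assumes "trivial_spectrum_subspace n \<V>"
  shows "trivial_spectrum_subspace n (transpose_mat ` \<V>)"
proof -
  have V: "\<V> \<subseteq> carrier_mat n n" "0\<^sub>m n n \<in> \<V>" "\<And>A B. A \<in> \<V> \<Longrightarrow> B \<in> \<V> \<Longrightarrow> A + B \<in> \<V>"
    "\<And>c A. A \<in> \<V> \<Longrightarrow> c \<cdot>\<^sub>m A \<in> \<V>"
    using assms by (auto simp: mat_subspace_iff trivial_spectrum_subspace_def)
  have "mat_subspace n (transpose_mat ` \<V>)"
    unfolding mat_subspace_iff
  proof (intro conjI ballI allI)
    show "0\<^sub>m n n \<in> transpose_mat ` \<V>"
      using V(2) by (metis imageI zero_transpose_mat)
  next
    fix A B assume "A \<in> transpose_mat ` \<V>" "B \<in> transpose_mat ` \<V>"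
    then obtain M N where "M \<in> \<V>" "N \<in> \<V>" "A = transpose_mat M" "B = transpose_mat N"
      by blast
    moreover from this have "transpose_mat M + transpose_mat N = transpose_mat (M + N)"
      using V(1) by (subst transpose_add[of _ n n]) auto
    ultimately show "A + B \<in> transpose_mat ` \<V>"
      using V(3) by simp
  next
    fix c A assume "A \<in> transpose_mat ` \<V>"
    then obtain M where "M \<in> \<V>" "A = transpose_mat M"
      by blast
    moreover have "c \<cdot>\<^sub>m transpose_mat M = transpose_mat (c \<cdot>\<^sub>m M)"
      by (intro eq_matI) auto
    ultimately show "c \<cdot>\<^sub>m A \<in> transpose_mat ` \<V>"
      using V(4) by auto
  qed (use V(1) in auto)
  moreover have "eigenvalue (transpose_mat M) k \<longleftrightarrow> eigenvalue M k" if "M \<in> \<V>" for M k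
    using V(1) that by (auto simp: eigenvalue_root_char_poly[of _ n])
  ultimately show ?thesis
    using assms by (auto simp: trivial_spectrum_subspace_def)
qed

section \<open>Block upper triangular joins\<close>

lemma mat_space_joinI:
  assumes "A \<in> \<A>" "B \<in> \<B>" "D \<in> carrier_mat n p"
  shows "four_block_mat A D (0\<^sub>m p n) B \<in> mat_space_join n p \<A> \<B>"
  using assms unfolding mat_space_join_def by blast

lemma mat_space_joinE:
  assumes "M \<in> mat_space_join n p \<A> \<B>"
  obtains A B D where "A \<in> \<A>" "B \<in> \<B>" "D \<in> carrier_mat n p"
    "M = four_block_mat A D (0\<^sub>m p n) B"
  using assms unfolding mat_space_join_def by blast

lemma mat_space_join_carrier:
  assumes "\<A> \<subseteq> carrier_mat n n" "\<B> \<subseteq> carrier_mat p p"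
  shows "mat_space_join n p \<A> \<B> \<subseteq> carrier_mat (n + p) (n + p)"
proof
  fix M assume "M \<in> mat_space_join n p \<A> \<B>"
  then show "M \<in> carrier_mat (n + p) (n + p)"
    using assms by (elim mat_space_joinE) (auto intro!: four_block_carrier_mat)
qed

lemma mat_subspace_join:
  fixes \<A> \<B> :: "'a::field mat set"
  assumes "mat_subspace n \<A>" "mat_subspace p \<B>"
  shows "mat_subspace (n + p) (mat_space_join n p \<A> \<B>)"
proof -
  let ?J = "mat_space_join n p \<A> \<B>"
  have A: "\<A> \<subseteq> carrier_mat n n" "0\<^sub>m n n \<in> \<A>" "\<And>M N. M \<in> \<A> \<Longrightarrow> N \<in> \<A> \<Longrightarrow> M + N \<in> \<A>"
    "\<And>c M. M \<in> \<A> \<Longrightarrow> c \<cdot>\<^sub>m M \<in> \<A>"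
    using assms(1) by (auto simp: mat_subspace_iff)
  have B: "\<B> \<subseteq> carrier_mat p p" "0\<^sub>m p p \<in> \<B>" "\<And>M N. M \<in> \<B> \<Longrightarrow> N \<in> \<B> \<Longrightarrow> M + N \<in> \<B>"
    "\<And>c M. M \<in> \<B> \<Longrightarrow> c \<cdot>\<^sub>m M \<in> \<B>"
    using assms(2) by (auto simp: mat_subspace_iff)
  show ?thesis
    unfolding mat_subspace_iff
  proof (intro conjI ballI allI)
    show "0\<^sub>m (n + p) (n + p) \<in> ?J"
      using mat_space_joinI[OF A(2) B(2) zero_carrier_mat[of n p]] by simp
  next
    fix M N assume "M \<in> ?J" "N \<in> ?J"
    then obtain A1 B1 D1 A2 B2 D2 where
      1: "A1 \<in> \<A>" "B1 \<in> \<B>" "D1 \<in> carrier_mat n p" "M = four_block_mat A1 D1 (0\<^sub>m p n) B1" and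
      2: "A2 \<in> \<A>" "B2 \<in> \<B>" "D2 \<in> carrier_mat n p" "N = four_block_mat A2 D2 (0\<^sub>m p n) B2"
      by (metis mat_space_joinE)
    then have "M + N = four_block_mat (A1 + A2) (D1 + D2) (0\<^sub>m p n) (B1 + B2)"
      using A(1) B(1) by (simp add: add_four_block_mat[of _ n n _ p _ p] subset_iff)
    then show "M + N \<in> ?J"
      using 1 2 A(3) B(3) mat_space_joinI[of "A1 + A2" \<A> "B1 + B2" \<B> "D1 + D2" n p] by simp
  next
    fix c M assume "M \<in> ?J"
    then obtain A1 B1 D1 where
      1: "A1 \<in> \<A>" "B1 \<in> \<B>" "D1 \<in> carrier_mat n p" "M = four_block_mat A1 D1 (0\<^sub>m p n) B1"
      by (metis mat_space_joinE)
    then have "c \<cdot>\<^sub>m M = four_block_mat (c \<cdot>\<^sub>m A1) (c \<cdot>\<^sub>m D1) (0\<^sub>m p n) (c \<cdot>\<^sub>m B1)"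
      using A(1) B(1) by (simp add: smult_four_block_mat[of _ n n _ p _ p] subset_iff)
    then show "c \<cdot>\<^sub>m M \<in> ?J"
      using 1 A(4) B(4) mat_space_joinI[of "c \<cdot>\<^sub>m A1" \<A> "c \<cdot>\<^sub>m B1" \<B> "c \<cdot>\<^sub>m D1" n p] by simp
  qed (use mat_space_join_carrier[OF A(1) B(1)] in auto)
qed

text \<open>The characteristic matrix of a block-triangular matrix is block-triangular, and its determinant
  is the product of the determinants of the diagonal blocks.\<close>

lemma eigenvalue_four_block_upper:
  fixes A B D :: "'a::field mat"
  assumes "A \<in> carrier_mat n n" "D \<in> carrier_mat n p" "B \<in> carrier_mat p p"
  shows "eigenvalue (four_block_mat A D (0\<^sub>m p n) B) k \<longleftrightarrow> eigenvalue A k \<or> eigenvalue B k"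
proof -
  let ?M = "four_block_mat A D (0\<^sub>m p n) B"
  have M: "?M \<in> carrier_mat (n + p) (n + p)"
    using assms by simp
  have "char_matrix ?M k = four_block_mat (char_matrix A k) D (0\<^sub>m p n) (char_matrix B k)"
    using assms by (intro eq_matI) (auto simp: char_matrix_def)
  then have "det (char_matrix ?M k) = det (char_matrix A k) * det (char_matrix B k)"
    using det_four_block_mat_lower_left_zero[of "char_matrix A k" n D p "0\<^sub>m p n" "char_matrix B k"]
      assms by simp
  then show ?thesis
    by (simp add: eigenvalue_det[OF M] eigenvalue_det[OF assms(1)] eigenvalue_det[OF assms(3)])
qed

lemma trivial_spectrum_subspace_join:
  fixes \<A> \<B> :: "'a::field mat set"
  assumes "trivial_spectrum_subspace n \<A>" "trivial_spectrum_subspace p \<B>"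
  shows "trivial_spectrum_subspace (n + p) (mat_space_join n p \<A> \<B>)"
proof -
  have "\<A> \<subseteq> carrier_mat n n" "\<B> \<subseteq> carrier_mat p p"
    using assms by (auto simp: trivial_spectrum_subspace_def mat_subspace_iff)
  then have "\<not> eigenvalue M k" if "M \<in> mat_space_join n p \<A> \<B>" "k \<noteq> 0" for M k
    using that assms
    by (elim mat_space_joinE)
      (auto simp: eigenvalue_four_block_upper trivial_spectrum_subspace_def subset_iff)
  then show ?thesis
    using assms mat_subspace_join by (auto simp: trivial_spectrum_subspace_def)
qed

text \<open>The span of the first \<open>n\<close> basis vectors is invariant.\<close>

lemma not_irreducible_join:
  fixes \<A> \<B> :: "'a::field mat set"
  assumes "\<A> \<subseteq> carrier_mat n n" "\<B> \<subseteq> carrier_mat p p" "n > 0" "p > 0"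
  shows "\<not> irreducible_mat_space (n + p) (mat_space_join n p \<A> \<B>)"
proof -
  let ?F = "{y @\<^sub>v 0\<^sub>v p | y. y \<in> carrier_vec n} :: 'a vec set"
  have "vec_subspace (n + p) ?F"
    unfolding vec_subspace_iff
  proof (intro conjI ballI allI)
    show "?F \<subseteq> carrier_vec (n + p)"
      by auto
    show "0\<^sub>v (n + p) \<in> ?F"
      by (auto intro!: exI[of _ "0\<^sub>v n"])
  next
    fix x z assume "x \<in> ?F" "z \<in> ?F"
    then obtain u v where "u \<in> carrier_vec n" "v \<in> carrier_vec n" "x = u @\<^sub>v 0\<^sub>v p" "z = v @\<^sub>v 0\<^sub>v p"
      by blast
    then show "x + z \<in> ?F"
      by (auto simp: append_vec_add[of _ n _ _ p] intro!: exI[of _ "u + v"])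
  next
    fix c x assume "x \<in> ?F"
    then obtain u where u: "u \<in> carrier_vec n" "x = u @\<^sub>v 0\<^sub>v p"
      by blast
    then have "c \<cdot>\<^sub>v x = (c \<cdot>\<^sub>v u) @\<^sub>v 0\<^sub>v p"
      by (intro eq_vecI) auto
    then show "c \<cdot>\<^sub>v x \<in> ?F"
      using u by (auto intro!: exI[of _ "c \<cdot>\<^sub>v u"])
  qed
  moreover have "?F \<noteq> {0\<^sub>v (n + p)}"
  proof
    assume eq: "?F = {0\<^sub>v (n + p)}"
    have "unit_vec n 0 @\<^sub>v 0\<^sub>v p \<in> ?F"
      by auto
    then have "(unit_vec n 0 @\<^sub>v 0\<^sub>v p) $ 0 = (0\<^sub>v (n + p) $ 0 :: 'a)"
      unfolding eq by simp
    then show False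
      using assms(3) by simp
  qed
  moreover have "?F \<noteq> carrier_vec (n + p)"
  proof
    assume eq: "?F = carrier_vec (n + p)"
    have "unit_vec (n + p) n \<in> ?F"
      unfolding eq by simp
    then obtain y :: "'a vec" where "y \<in> carrier_vec n" "unit_vec (n + p) n = y @\<^sub>v 0\<^sub>v p"
      by blast
    then have "unit_vec (n + p) n $ n = (0 :: 'a)"
      using assms(4) by simp
    then show False
      using assms(4) by simp
  qed
  moreover have "M *\<^sub>v x \<in> ?F" if M: "M \<in> mat_space_join n p \<A> \<B>" and x: "x \<in> ?F" for M x
  proof -
    obtain A B D where ABD: "A \<in> \<A>" "B \<in> \<B>" "D \<in> carrier_mat n p"
      "M = four_block_mat A D (0\<^sub>m p n) B"
      using M by (rule mat_space_joinE)
    obtain y where y: "y \<in> carrier_vec n" "x = y @\<^sub>v 0\<^sub>v p"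
      using x by blast
    have AB: "A \<in> carrier_mat n n" "B \<in> carrier_mat p p"
      using ABD assms by auto
    have "D *\<^sub>v 0\<^sub>v p = 0\<^sub>v n" "0\<^sub>m p n *\<^sub>v y = 0\<^sub>v p" "B *\<^sub>v 0\<^sub>v p = 0\<^sub>v p"
      using AB ABD(3) y by (auto intro!: eq_vecI simp: scalar_prod_def)
    then have "M *\<^sub>v x = (A *\<^sub>v y) @\<^sub>v 0\<^sub>v p"
      using AB ABD(3) y by (simp add: ABD(4) four_block_mat_mult_vec[of _ n n _ p _ p])
    then show ?thesis
      using AB(1) y(1) by auto
  qed
  ultimately show ?thesis
    unfolding irreducible_mat_space_def by blast
qed

text \<open>The three blocks are chosen independently.\<close>

lemma card_mat_space_join:
  fixes \<A> \<B> :: "'a::field mat set"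
  assumes "\<A> \<subseteq> carrier_mat n n" "\<B> \<subseteq> carrier_mat p p"
  shows "card (mat_space_join n p \<A> \<B>) =
    card \<A> * card \<B> * card (carrier_mat n p :: 'a mat set)"
proof -
  let ?f = "\<lambda>((A :: 'a mat, B), D). four_block_mat A D (0\<^sub>m p n) B"
  let ?X = "(\<A> \<times> \<B>) \<times> carrier_mat n p"
  have "mat_space_join n p \<A> \<B> = ?f ` ?X"
    unfolding mat_space_join_def by force
  moreover have "inj_on ?f ?X"
  proof (rule inj_onI)
    fix X Y assume XY: "X \<in> ?X" "Y \<in> ?X" and "?f X = ?f Y"
    moreover obtain A B D A' B' D' where X: "X = ((A, B), D)" and Y: "Y = ((A', B'), D')"
      by (metis surj_pair)
    ultimately have *: "A \<in> \<A>" "B \<in> \<B>" "A' \<in> \<A>" "B' \<in> \<B>"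
      and D: "D \<in> carrier_mat n p" "D' \<in> carrier_mat n p"
      and eq: "four_block_mat A D (0\<^sub>m p n) B = four_block_mat A' D' (0\<^sub>m p n) B'"
      by auto
    have car: "A \<in> carrier_mat n n" "A' \<in> carrier_mat n n" "B \<in> carrier_mat p p"
      "B' \<in> carrier_mat p p"
      using * assms by auto
    have entry: "four_block_mat A D (0\<^sub>m p n) B $$ ij = four_block_mat A' D' (0\<^sub>m p n) B' $$ ij" for ij
      by (simp only: eq)
    have "A $$ (i, j) = A' $$ (i, j)" if "i < n" "j < n" for i j
      using entry[of "(i, j)"] car D that by simp
    moreover have "D $$ (i, j) = D' $$ (i, j)" if "i < n" "j < p" for i j
      using entry[of "(i, n + j)"] car D that by simp
    moreover have "B $$ (i, j) = B' $$ (i, j)" if "i < p" "j < p" for i j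
      using entry[of "(n + i, n + j)"] car that by simp
    ultimately show "X = Y"
      unfolding X Y using car D by (auto intro!: eq_matI)
  qed
  ultimately show ?thesis
    by (simp add: card_image card_cartesian_product)
qed

lemma conj_block_diag:
  fixes A B D P Q R S :: "'a::field mat"
  assumes "P \<in> carrier_mat n n" "Q \<in> carrier_mat n n" "R \<in> carrier_mat p p" "S \<in> carrier_mat p p"
    "A \<in> carrier_mat n n" "B \<in> carrier_mat p p" "D \<in> carrier_mat n p"
  shows "four_block_mat P (0\<^sub>m n p) (0\<^sub>m p n) R * four_block_mat A D (0\<^sub>m p n) B *
      four_block_mat Q (0\<^sub>m n p) (0\<^sub>m p n) S =
    four_block_mat (P * A * Q) (P * D * S) (0\<^sub>m p n) (R * B * S)"
proof -
  have "four_block_mat P (0\<^sub>m n p) (0\<^sub>m p n) R * four_block_mat A D (0\<^sub>m p n) B =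
      four_block_mat (P * A) (P * D) (0\<^sub>m p n) (R * B)"
    using assms by (subst mult_four_block_mat[of _ n n _ p _ p _ _ n _ p]) auto
  moreover have "four_block_mat (P * A) (P * D) (0\<^sub>m p n) (R * B) *
      four_block_mat Q (0\<^sub>m n p) (0\<^sub>m p n) S =
    four_block_mat (P * A * Q) (P * D * S) (0\<^sub>m p n) (R * B * S)"
    using assms by (subst mult_four_block_mat[of _ n n _ p _ p _ _ n _ p]) auto
  ultimately show ?thesis
    by simp
qed

text \<open>Conjugation by a block-diagonal matrix conjugates the diagonal blocks separately and permutes the
  arbitrary upper right blocks.\<close>

lemma similar_mat_spaces_join:
  fixes \<A> \<B> :: "'a::field mat set"
  assumes sim: "similar_mat_spaces n \<A> \<A>'" "similar_mat_spaces p \<B> \<B>'"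
    and car: "\<A> \<subseteq> carrier_mat n n" "\<B> \<subseteq> carrier_mat p p"
  shows "similar_mat_spaces (n + p) (mat_space_join n p \<A> \<B>) (mat_space_join n p \<A>' \<B>')"
proof -
  obtain P Q where PQ: "P \<in> carrier_mat n n" "Q \<in> carrier_mat n n" "P * Q = 1\<^sub>m n"
    "Q * P = 1\<^sub>m n" and A': "\<A>' = (\<lambda>M. P * M * Q) ` \<A>"
    using sim(1) by (rule similar_mat_spacesE)
  obtain R S where RS: "R \<in> carrier_mat p p" "S \<in> carrier_mat p p" "R * S = 1\<^sub>m p"
    "S * R = 1\<^sub>m p" and B': "\<B>' = (\<lambda>M. R * M * S) ` \<B>"
    using sim(2) by (rule similar_mat_spacesE)
  let ?T = "four_block_mat P (0\<^sub>m n p) (0\<^sub>m p n) R"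
  let ?U = "four_block_mat Q (0\<^sub>m n p) (0\<^sub>m p n) S"
  show ?thesis
  proof (rule similar_mat_spacesI[of ?T _ ?U])
    show "?T * ?U = 1\<^sub>m (n + p)" "?U * ?T = 1\<^sub>m (n + p)"
      using PQ RS by (simp_all add: mult_four_block_mat[of _ n n _ p _ p _ _ n _ p])
    show "mat_space_join n p \<A>' \<B>' = (\<lambda>M. ?T * M * ?U) ` mat_space_join n p \<A> \<B>"
    proof (intro Set.set_eqI iffI)
      fix M assume "M \<in> mat_space_join n p \<A>' \<B>'"
      then obtain A B D where ABD: "A \<in> \<A>" "B \<in> \<B>" "D \<in> carrier_mat n p"
        "M = four_block_mat (P * A * Q) D (0\<^sub>m p n) (R * B * S)"
        unfolding A' B' by (elim mat_space_joinE) blast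
      \<comment> \<open>The free block of the preimage is \<open>Q D R\<close>, since \<open>P (Q D R) S = D\<close>.\<close>
      have "P * (Q * (D * (R * S))) = (P * Q) * (D * (R * S))"
        using PQ(1,2) RS(1,2) ABD(3) by (intro assoc_mult_mat[of P n n Q n _ p, symmetric]) auto
      then have D: "P * (Q * D * R) * S = D"
        using PQ RS ABD(3) by (simp add: assoc_mult_mat[of _ n n _ n _ p]
            assoc_mult_mat[of _ n n _ p _ p] assoc_mult_mat[of _ n p _ p _ p])
      have "?T * four_block_mat A (Q * D * R) (0\<^sub>m p n) B * ?U =
          four_block_mat (P * A * Q) (P * (Q * D * R) * S) (0\<^sub>m p n) (R * B * S)"
        using PQ(1,2) RS(1,2) ABD car by (intro conj_block_diag) auto
      then have "M = ?T * four_block_mat A (Q * D * R) (0\<^sub>m p n) B * ?U"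
        by (simp only: D ABD(4))
      moreover have "four_block_mat A (Q * D * R) (0\<^sub>m p n) B \<in> mat_space_join n p \<A> \<B>"
        using PQ(1,2) RS(1,2) ABD by (intro mat_space_joinI) auto
      ultimately show "M \<in> (\<lambda>M. ?T * M * ?U) ` mat_space_join n p \<A> \<B>"
        by blast
    next
      fix M assume "M \<in> (\<lambda>M. ?T * M * ?U) ` mat_space_join n p \<A> \<B>"
      then obtain A B D where ABD: "A \<in> \<A>" "B \<in> \<B>" "D \<in> carrier_mat n p"
        "M = ?T * four_block_mat A D (0\<^sub>m p n) B * ?U"
        by (auto elim!: mat_space_joinE)
      have "M = four_block_mat (P * A * Q) (P * D * S) (0\<^sub>m p n) (R * B * S)"
        unfolding ABD(4) using PQ(1,2) RS(1,2) ABD car by (intro conj_block_diag) auto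
      then show "M \<in> mat_space_join n p \<A>' \<B>'"
        using PQ(1,2) RS(1,2) ABD unfolding A' B' by (auto intro!: mat_space_joinI)
    qed
  qed (use PQ RS in auto)
qed

text \<open>The transpose of a join is block lower triangular; exchanging the two groups of coordinates makes
  it block upper triangular again, with the diagonal blocks in the opposite order.\<close>

lemma similar_mat_spaces_transpose_join:
  fixes \<A> \<B> :: "'a::field mat set"
  assumes car: "\<A> \<subseteq> carrier_mat n n" "\<B> \<subseteq> carrier_mat p p"
  shows "similar_mat_spaces (n + p) (transpose_mat ` mat_space_join n p \<A> \<B>)
    (mat_space_join p n (transpose_mat ` \<B>) (transpose_mat ` \<A>))"
proof -
  let ?T = "four_block_mat (0\<^sub>m p n) (1\<^sub>m p) (1\<^sub>m n) (0\<^sub>m n p) :: 'a mat"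
  let ?U = "four_block_mat (0\<^sub>m n p) (1\<^sub>m n) (1\<^sub>m p) (0\<^sub>m p n) :: 'a mat"
  have conj: "?T * transpose_mat (four_block_mat A D (0\<^sub>m p n) B) * ?U =
      four_block_mat (transpose_mat B) (transpose_mat D) (0\<^sub>m n p) (transpose_mat A)"
    if "A \<in> carrier_mat n n" "B \<in> carrier_mat p p" "D \<in> carrier_mat n p" for A B D
  proof -
    have "?T * transpose_mat (four_block_mat A D (0\<^sub>m p n) B) =
        four_block_mat (transpose_mat D) (transpose_mat B) (transpose_mat A) (0\<^sub>m n p)"
      using that
      by (simp add: transpose_four_block_mat[of _ n n _ p _ p]
          mult_four_block_mat[of _ p n _ p _ n _ _ n _ p])
    also have "\<dots> * ?U =
        four_block_mat (transpose_mat B) (transpose_mat D) (0\<^sub>m n p) (transpose_mat A)"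
      using that by (subst mult_four_block_mat[of _ p n _ p _ n _ _ p _ n]) auto
    finally show ?thesis .
  qed
  have "mat_space_join p n (transpose_mat ` \<B>) (transpose_mat ` \<A>) =
      (\<lambda>M. ?T * M * ?U) ` (transpose_mat ` mat_space_join n p \<A> \<B>)"
  proof (intro Set.set_eqI iffI)
    fix M assume "M \<in> mat_space_join p n (transpose_mat ` \<B>) (transpose_mat ` \<A>)"
    then obtain A B D where ABD: "A \<in> \<A>" "B \<in> \<B>" "D \<in> carrier_mat p n"
      "M = four_block_mat (transpose_mat B) D (0\<^sub>m n p) (transpose_mat A)"
      by (elim mat_space_joinE) blast
    have "M = ?T * transpose_mat (four_block_mat A (transpose_mat D) (0\<^sub>m p n) B) * ?U"
      using ABD car by (subst conj) auto
    moreover have "four_block_mat A (transpose_mat D) (0\<^sub>m p n) B \<in> mat_space_join n p \<A> \<B>"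
      using ABD by (intro mat_space_joinI) auto
    ultimately show "M \<in> (\<lambda>M. ?T * M * ?U) ` (transpose_mat ` mat_space_join n p \<A> \<B>)"
      by blast
  next
    fix M assume "M \<in> (\<lambda>M. ?T * M * ?U) ` (transpose_mat ` mat_space_join n p \<A> \<B>)"
    then obtain A B D where ABD: "A \<in> \<A>" "B \<in> \<B>" "D \<in> carrier_mat n p"
      "M = ?T * transpose_mat (four_block_mat A D (0\<^sub>m p n) B) * ?U"
      by (auto elim!: mat_space_joinE)
    have "M = four_block_mat (transpose_mat B) (transpose_mat D) (0\<^sub>m n p) (transpose_mat A)"
      unfolding ABD(4) using ABD car by (intro conj) auto
    then show "M \<in> mat_space_join p n (transpose_mat ` \<B>) (transpose_mat ` \<A>)"
      using ABD by (auto intro!: mat_space_joinI)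
  qed
  moreover have "?T * ?U = 1\<^sub>m (p + n)" "?U * ?T = 1\<^sub>m (n + p)"
    by (simp_all add: mult_four_block_mat[of _ p n _ p _ n _ _ p _ n]
        mult_four_block_mat[of _ n p _ n _ p _ _ n _ p])
  moreover have "?T \<in> carrier_mat (p + n) (n + p)" "?U \<in> carrier_mat (n + p) (p + n)"
    by (auto intro!: four_block_carrier_mat)
  ultimately show ?thesis
    by (intro similar_mat_spacesI[of ?T "n + p" ?U]) (simp_all add: add.commute)
qed

section \<open>Common kernel vectors and reducibility\<close>

lemma det_nonzero_obtain_inverse:
  fixes P :: "'a::field mat"
  assumes P: "P \<in> carrier_mat n n" and "det P \<noteq> 0"
  obtains Q where "Q \<in> carrier_mat n n" "P * Q = 1\<^sub>m n" "Q * P = 1\<^sub>m n"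
  using det_non_zero_imp_unit[OF assms, of undefined]
  unfolding Units_def by (auto simp: ring_mat_simps)

text \<open>The columns of \<open>P\<close> are \<open>x\<close> completed to a basis by unit vectors.\<close>

lemma obtain_invertible_with_first_column:
  fixes x :: "'a::field vec"
  assumes x: "x \<in> carrier_vec n" "x \<noteq> 0\<^sub>v n"
  obtains P Q where "P \<in> carrier_mat n n" "Q \<in> carrier_mat n n" "P * Q = 1\<^sub>m n"
    "Q * P = 1\<^sub>m n" "P *\<^sub>v unit_vec n 0 = x"
proof -
  interpret vec_space "TYPE('a)" n .
  let ?b = "basis_completion x"
  let ?P = "mat_of_cols n ?b"
  note b = basis_completion[OF x]
  have n: "n > 0"
    using x by (cases n) auto
  have P: "?P \<in> carrier_mat n n"
    using mat_of_cols_carrier(1)[of n ?b] b(6) by simp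
  have cols: "cols ?P = ?b"
    using b(2) by (rule cols_mat_of_cols)
  have "rank ?P = n"
    by (rule lin_indpt_full_rank[OF P]) (simp_all only: cols b not_False_eq_True)
  then have "det ?P \<noteq> 0"
    by (simp add: det_rank_iff[OF P])
  then obtain Q where Q: "Q \<in> carrier_mat n n" "?P * Q = 1\<^sub>m n" "Q * ?P = 1\<^sub>m n"
    using det_nonzero_obtain_inverse[OF P] by blast
  have "?P *\<^sub>v unit_vec n 0 = col ?P 0"
    using P n by (intro eq_vecI) auto
  also have "\<dots> = ?b ! 0"
    using b(2,6) n by (intro col_mat_of_cols) (auto simp: subset_iff)
  also have "\<dots> = x"
    using b(6,7) n by (metis hd_conv_nth length_0_conv less_irrefl)
  finally show ?thesis
    by (rule that[OF P Q])
qed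

text \<open>The existence of such a vector is a similarity invariant. Applied to a space and to its transpose, it
  both drives the classification and separates the three classes.\<close>

definition has_common_kernel_vector :: "nat \<Rightarrow> 'a::field mat set \<Rightarrow> bool" where
  "has_common_kernel_vector n \<V> \<longleftrightarrow>
     (\<exists>x \<in> carrier_vec n. x \<noteq> 0\<^sub>v n \<and> (\<forall>M \<in> \<V>. M *\<^sub>v x = 0\<^sub>v n))"

lemma similar_mat_spaces_common_kernel:
  fixes \<V> :: "'a::field mat set"
  assumes "similar_mat_spaces n \<V> \<W>" "\<V> \<subseteq> carrier_mat n n" "has_common_kernel_vector n \<V>"
  shows "has_common_kernel_vector n \<W>"
proof -
  obtain P Q where PQ: "P \<in> carrier_mat n n" "Q \<in> carrier_mat n n" "P * Q = 1\<^sub>m n"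
    "Q * P = 1\<^sub>m n" and W: "\<W> = (\<lambda>M. P * M * Q) ` \<V>"
    using assms(1) by (rule similar_mat_spacesE)
  obtain x where x: "x \<in> carrier_vec n" "x \<noteq> 0\<^sub>v n" "\<And>M. M \<in> \<V> \<Longrightarrow> M *\<^sub>v x = 0\<^sub>v n"
    using assms(3) unfolding has_common_kernel_vector_def by blast
  have zero: "A *\<^sub>v 0\<^sub>v n = 0\<^sub>v n" if "A \<in> carrier_mat n n" for A :: "'a mat"
    using that by (intro eq_vecI) auto
  have "Q *\<^sub>v (P *\<^sub>v x) = (Q * P) *\<^sub>v x"
    using PQ(1,2) x(1) by (simp add: assoc_mult_mat_vec[of _ n n _ n])
  then have "Q *\<^sub>v (P *\<^sub>v x) = x"
    using PQ(4) x(1) by simp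
  then have "P *\<^sub>v x \<noteq> 0\<^sub>v n"
    using x(2) zero[OF PQ(2)] by metis
  moreover have "(P * M * Q) *\<^sub>v (P *\<^sub>v x) = 0\<^sub>v n" if "M \<in> \<V>" for M
    using conj_mat_mult_vec[OF PQ(1,2,4) _ x(1)] that assms(2) x(3) zero[OF PQ(1)] by auto
  ultimately show ?thesis
    using PQ(1) x(1) unfolding has_common_kernel_vector_def W by (auto intro!: bexI[of _ "P *\<^sub>v x"])
qed

text \<open>Every eigenvalue in the field is zero, so an invariant line is annihilated.\<close>

lemma trivial_spectrum_common_eigenvector:
  fixes \<V> :: "'a::field mat set"
  assumes "trivial_spectrum_subspace n \<V>" "x \<in> carrier_vec n" "x \<noteq> 0\<^sub>v n"
    and eig: "\<And>M. M \<in> \<V> \<Longrightarrow> \<exists>c. M *\<^sub>v x = c \<cdot>\<^sub>v x"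
  shows "has_common_kernel_vector n \<V>"
proof -
  have "M *\<^sub>v x = 0\<^sub>v n" if M: "M \<in> \<V>" for M
  proof -
    obtain c where c: "M *\<^sub>v x = c \<cdot>\<^sub>v x"
      using eig[OF M] by blast
    have "M \<in> carrier_mat n n"
      using M assms(1) by (auto simp: trivial_spectrum_subspace_def mat_subspace_iff)
    then have "eigenvalue M c"
      using c assms(2,3) by (auto simp: eigenvalue_def eigenvector_def)
    then have "c = 0"
      using M assms(1) by (auto simp: trivial_spectrum_subspace_def)
    then show ?thesis
      using c assms(2) by (intro eq_vecI) auto
  qed
  then show ?thesis
    using assms(2,3) unfolding has_common_kernel_vector_def by blast
qed

lemma has_common_kernel_vector_join_zero:
  fixes \<B> :: "'a::field mat set"
  assumes "\<B> \<subseteq> carrier_mat p p" "n > 0"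
  shows "has_common_kernel_vector (n + p) (mat_space_join n p {0\<^sub>m n n} \<B>)"
proof -
  let ?x = "unit_vec n 0 @\<^sub>v 0\<^sub>v p :: 'a vec"
  have "?x $ 0 \<noteq> 0\<^sub>v (n + p) $ 0"
    using assms(2) by simp
  then have "?x \<noteq> 0\<^sub>v (n + p)"
    by metis
  moreover have "M *\<^sub>v ?x = 0\<^sub>v (n + p)" if M: "M \<in> mat_space_join n p {0\<^sub>m n n} \<B>" for M
  proof -
    obtain B D where BD: "B \<in> carrier_mat p p" "D \<in> carrier_mat n p"
      "M = four_block_mat (0\<^sub>m n n) D (0\<^sub>m p n) B"
      using M assms(1) by (elim mat_space_joinE) auto
    then have "0\<^sub>m n n *\<^sub>v unit_vec n 0 + D *\<^sub>v 0\<^sub>v p = 0\<^sub>v n"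
      "0\<^sub>m p n *\<^sub>v unit_vec n 0 + B *\<^sub>v 0\<^sub>v p = 0\<^sub>v p"
      by (auto intro!: eq_vecI)
    then have "M *\<^sub>v ?x = 0\<^sub>v n @\<^sub>v 0\<^sub>v p"
      using BD by (simp add: four_block_mat_mult_vec[of _ n n _ p _ p])
    then show ?thesis
      by (auto intro: eq_vecI)
  qed
  ultimately show ?thesis
    unfolding has_common_kernel_vector_def by (intro bexI[of _ ?x]) auto
qed

text \<open>Since the upper right block is arbitrary, a joint null vector of a join vanishes on the last
  coordinates; its first part is then annihilated by the upper left blocks.\<close>

lemma has_common_kernel_vector_joinD:
  fixes \<A> \<B> :: "'a::field mat set"
  assumes ker: "has_common_kernel_vector (n + p) (mat_space_join n p \<A> \<B>)"
    and car: "\<A> \<subseteq> carrier_mat n n" "\<B> \<subseteq> carrier_mat p p"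
    and zero: "0\<^sub>m n n \<in> \<A>" "0\<^sub>m p p \<in> \<B>" and n: "n > 0"
  shows "has_common_kernel_vector n \<A>"
proof -
  obtain x where x: "x \<in> carrier_vec (n + p)" "x \<noteq> 0\<^sub>v (n + p)"
    "\<And>M. M \<in> mat_space_join n p \<A> \<B> \<Longrightarrow> M *\<^sub>v x = 0\<^sub>v (n + p)"
    using ker unfolding has_common_kernel_vector_def by blast
  define y z where "y = vec_first x n" and "z = vec_last x p"
  have yz: "y \<in> carrier_vec n" "z \<in> carrier_vec p" "x = y @\<^sub>v z"
    using x(1) by (simp_all add: y_def z_def)
  have ADz: "A *\<^sub>v y + D *\<^sub>v z = 0\<^sub>v n" if "A \<in> \<A>" "D \<in> carrier_mat n p" for A D
  proof -
    have A: "A \<in> carrier_mat n n"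
      using that(1) car(1) by blast
    have "(A *\<^sub>v y + D *\<^sub>v z) @\<^sub>v (0\<^sub>m p n *\<^sub>v y + 0\<^sub>m p p *\<^sub>v z) = 0\<^sub>v (n + p)"
      using x(3)[OF mat_space_joinI[OF that(1) zero(2) that(2)]] A that(2) yz
      by (simp add: four_block_mat_mult_vec[of _ n n _ p _ p])
    also have "0\<^sub>v (n + p) = 0\<^sub>v n @\<^sub>v (0\<^sub>v p :: 'a vec)"
      by (intro eq_vecI) auto
    finally show ?thesis
      using A that(2) yz(1,2) by (subst (asm) append_vec_eq[of _ n]) auto
  qed
  have z: "z = 0\<^sub>v p"
  proof (rule eq_vecI)
    fix j assume j: "j < dim_vec (0\<^sub>v p :: 'a vec)"
    \<comment> \<open>The matrix whose first row is the \<open>j\<close>-th unit vector reads off the entry \<open>z $ j\<close>.\<close>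
    let ?D = "mat n p (\<lambda>(_, k). if k = j then 1 else 0) :: 'a mat"
    have "0\<^sub>m n n *\<^sub>v y + ?D *\<^sub>v z = 0\<^sub>v n"
      by (rule ADz[OF zero(1)]) simp
    then have "(0\<^sub>m n n *\<^sub>v y + ?D *\<^sub>v z) $ 0 = 0"
      using n by simp
    moreover have "row ?D 0 = unit_vec p j"
      using n by (intro eq_vecI) (auto simp: unit_vec_def)
    ultimately show "z $ j = 0\<^sub>v p $ j"
      using n j yz(1,2) by (simp add: scalar_prod_left_unit)
  qed (use yz in simp)
  have "y \<noteq> 0\<^sub>v n"
    using x(2) yz(3) z by auto
  moreover have "A *\<^sub>v y = 0\<^sub>v n" if "A \<in> \<A>" for A
  proof -
    have "A *\<^sub>v y \<in> carrier_vec n"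
      using that car(1) yz(1) by (auto intro!: mult_mat_vec_carrier)
    moreover have "0\<^sub>m n p *\<^sub>v z = 0\<^sub>v n"
      using yz(2) by (intro eq_vecI) auto
    ultimately show ?thesis
      using ADz[OF that, of "0\<^sub>m n p"] by simp
  qed
  ultimately show ?thesis
    using yz(1) unfolding has_common_kernel_vector_def by blast
qed

text \<open>An invariant subspace of \<open>F\<^sub>2\<^sup>3\<close> that is neither zero nor everything is a line or a plane. An
  invariant line is annihilated. An invariant plane is the kernel of a linear form \<open>l\<close>, and \<open>l\<close> then
  spans an invariant line of the transposed space, which is annihilated for the same reason.\<close>

lemma reducible_imp_common_kernel_vector:
  fixes \<V> :: "bit mat set"
  assumes ts: "trivial_spectrum_subspace 3 \<V>" and red: "\<not> irreducible_mat_space 3 \<V>"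
  shows "has_common_kernel_vector 3 \<V> \<or> has_common_kernel_vector 3 (transpose_mat ` \<V>)"
proof -
  obtain F where F: "vec_subspace 3 F" "F \<noteq> {0\<^sub>v 3}" "F \<noteq> carrier_vec 3"
    and inv: "\<And>M x. M \<in> \<V> \<Longrightarrow> x \<in> F \<Longrightarrow> M *\<^sub>v x \<in> F"
    using red unfolding irreducible_mat_space_def by blast
  have car: "\<V> \<subseteq> carrier_mat 3 3"
    using ts by (auto simp: trivial_spectrum_subspace_def mat_subspace_iff)
  have F_car: "F \<subseteq> carrier_vec 3" and F0: "0\<^sub>v 3 \<in> F"
    and F_add: "\<And>x y. x \<in> F \<Longrightarrow> y \<in> F \<Longrightarrow> x + y \<in> F"
    and F_smult: "\<And>c x. x \<in> F \<Longrightarrow> c \<cdot>\<^sub>v x \<in> F"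
    using F(1) by (auto simp: vec_subspace_iff)
  obtain x where x: "x \<in> F" "x \<noteq> 0\<^sub>v 3"
    using F(2) F0 by blast
  have xc: "x \<in> carrier_vec 3"
    using x(1) F_car by blast
  show ?thesis
  proof (cases "F = {0\<^sub>v 3, x}")
    case True
    have "\<exists>c. M *\<^sub>v x = c \<cdot>\<^sub>v x" if "M \<in> \<V>" for M
    proof -
      have "M *\<^sub>v x \<in> {0\<^sub>v 3, x}"
        using inv[OF that x(1)] True by simp
      then have "M *\<^sub>v x = 0 \<cdot>\<^sub>v x \<or> M *\<^sub>v x = 1 \<cdot>\<^sub>v x"
        using xc by auto
      then show ?thesis
        by blast
    qed
    then show ?thesis
      using trivial_spectrum_common_eigenvector[OF ts xc x(2)] by blast
  next
    case False
    then obtain y where y: "y \<in> F" "y \<noteq> 0\<^sub>v 3" "y \<noteq> x"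
      using x(1) F0 by blast
    obtain z where z: "z \<in> carrier_vec 3" "z \<notin> F"
      using F(3) F_car by blast
    have yc: "y \<in> carrier_vec 3"
      using y(1) F_car by blast
    let ?P = "mat_of_cols 3 [x, y, z]"
    have P: "?P \<in> carrier_mat 3 3"
      using mat_of_cols_carrier(1)[of 3 "[x, y, z]"] by (simp add: numeral_3_eq_3)
    have P_mult: "?P *\<^sub>v v = v $ 0 \<cdot>\<^sub>v x + v $ 1 \<cdot>\<^sub>v y + v $ 2 \<cdot>\<^sub>v z"
      if "v \<in> carrier_vec 3" for v
      using that xc yc z(1)
      by (intro eq_vecI)
        (auto simp: mat_of_cols_def scalar_prod_def numeral_3_eq_3 numeral_2_eq_2 mult.commute)
    \<comment> \<open>The plane is exactly the span of \<open>x\<close> and \<open>y\<close>.\<close>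
    have coord: "v $ 2 = 0" if v: "v \<in> carrier_vec 3" "?P *\<^sub>v v \<in> F" for v
    proof (rule ccontr)
      assume "v $ 2 \<noteq> 0"
      then have "?P *\<^sub>v v = v $ 0 \<cdot>\<^sub>v x + v $ 1 \<cdot>\<^sub>v y + z"
        using P_mult[OF v(1)] z(1) by simp
      \<comment> \<open>In characteristic 2, adding the component along \<open>x\<close> and \<open>y\<close> a second time removes it.\<close>
      moreover have "(v $ 0 \<cdot>\<^sub>v x + v $ 1 \<cdot>\<^sub>v y) + (v $ 0 \<cdot>\<^sub>v x + v $ 1 \<cdot>\<^sub>v y + z) = z"
        using xc yc z(1) by (intro eq_vecI) (auto simp: add.assoc[symmetric])
      ultimately show False
        using z(2) v(2) F_add F_smult x(1) y(1) by metis
    qed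
    \<comment> \<open>Hence \<open>x\<close>, \<open>y\<close>, \<open>z\<close> are linearly independent.\<close>
    have "v = 0\<^sub>v 3" if v: "v \<in> carrier_vec 3" "?P *\<^sub>v v = 0\<^sub>v 3" for v
    proof -
      have v2: "v $ 2 = 0"
        using coord[OF v(1)] v(2) F0 by simp
      have smult_0: "0 \<cdot>\<^sub>v u = 0\<^sub>v 3" if "u \<in> carrier_vec 3" for u :: "bit vec"
        using that by (intro eq_vecI) auto
      have eq: "v $ 0 \<cdot>\<^sub>v x + v $ 1 \<cdot>\<^sub>v y = 0\<^sub>v 3"
        using smult_0[OF z(1)] v2 P_mult[OF v(1)] v(2) xc yc z(1) by simp
      have xy: "x + y \<noteq> 0\<^sub>v 3"
      proof
        assume "x + y = 0\<^sub>v 3"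
        then have "x + (x + y) = x"
          using xc by simp
        moreover have "x + (x + y) = y"
          using xc yc by (intro eq_vecI) (auto simp: add.assoc[symmetric])
        ultimately show False
          using y(3) by simp
      qed
      have "v $ 0 = 0 \<and> v $ 1 = 0"
        using eq x(2) y(2) xy xc yc smult_0[OF xc] smult_0[OF yc]
        by (cases "v $ 0"; cases "v $ 1") auto
      then show ?thesis
        using v(1) v2 by (intro eq_vecI) (auto simp: less_Suc_eq numeral_3_eq_3 numeral_2_eq_2)
    qed
    then have det: "det ?P \<noteq> 0"
      using det_0_iff_vec_prod_zero_field[OF P] by blast
    obtain Q where Q: "Q \<in> carrier_mat 3 3" "?P * Q = 1\<^sub>m 3" "Q * ?P = 1\<^sub>m 3"
      using det_nonzero_obtain_inverse[OF P det] by blast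
    \<comment> \<open>The linear form with kernel \<open>F\<close>: the third coordinate in the basis \<open>x\<close>, \<open>y\<close>, \<open>z\<close>.\<close>
    define l where "l = row Q 2"
    have l: "l \<in> carrier_vec 3"
      unfolding l_def by (rule row_carrier_vec[OF _ Q(1)]) simp
    have l_F: "l \<bullet> v = 0" if "v \<in> F" for v
    proof -
      have v: "v \<in> carrier_vec 3"
        using that F_car by blast
      have "?P *\<^sub>v (Q *\<^sub>v v) = v"
        using P Q(1,2) v by (simp add: assoc_mult_mat_vec[of _ 3 3 _ 3, symmetric])
      then have "(Q *\<^sub>v v) $ 2 = 0"
        using coord[of "Q *\<^sub>v v"] Q(1) v that by simp
      then show ?thesis
        using Q(1) by (simp add: l_def)
    qed
    \<comment> \<open>A form vanishing on \<open>x\<close> and \<open>y\<close> is determined by its value at \<open>z\<close>.\<close>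
    have l_char: "m = (m \<bullet> z) \<cdot>\<^sub>v l"
      if m: "m \<in> carrier_vec 3" "m \<bullet> x = 0" "m \<bullet> y = 0" for m
    proof -
      have "transpose_mat ?P *\<^sub>v m = (m \<bullet> z) \<cdot>\<^sub>v unit_vec 3 2"
        using m xc yc z(1)
        by (intro eq_vecI)
          (auto simp: less_Suc_eq numeral_3_eq_3 numeral_2_eq_2 comm_scalar_prod[of _ 3])
      then have "transpose_mat Q *\<^sub>v (transpose_mat ?P *\<^sub>v m) =
          (m \<bullet> z) \<cdot>\<^sub>v (transpose_mat Q *\<^sub>v unit_vec 3 2)"
        using Q(1) by (simp add: mult_mat_vec[of _ 3 3])
      moreover have "transpose_mat Q *\<^sub>v unit_vec 3 2 = l"
        using Q(1) by (intro eq_vecI) (auto simp: l_def)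
      moreover have "transpose_mat Q *\<^sub>v (transpose_mat ?P *\<^sub>v m) = m"
      proof -
        have "transpose_mat Q *\<^sub>v (transpose_mat ?P *\<^sub>v m) =
            (transpose_mat Q * transpose_mat ?P) *\<^sub>v m"
          using P Q(1) m(1) by (intro assoc_mult_mat_vec[symmetric]) auto
        also have "transpose_mat Q * transpose_mat ?P = 1\<^sub>m 3"
          using transpose_mult[OF P Q(1)] Q(2) by simp
        finally show ?thesis
          using m(1) by simp
      qed
      ultimately show ?thesis
        by simp
    qed
    have "l \<noteq> 0\<^sub>v 3"
    proof
      assume "l = 0\<^sub>v 3"
      then have "row Q 2 \<bullet> col ?P 2 = 0"
        using z(1) by (simp add: l_def)
      moreover have "row Q 2 \<bullet> col ?P 2 = (Q * ?P) $$ (2, 2)"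
        using Q(1) P by simp
      ultimately show False
        by (simp add: Q(3))
    qed
    moreover have "\<exists>c. A *\<^sub>v l = c \<cdot>\<^sub>v l" if A: "A \<in> transpose_mat ` \<V>" for A
    proof -
      obtain M where M: "M \<in> \<V>" "A = transpose_mat M"
        using A by blast
      have Mc: "M \<in> carrier_mat 3 3"
        using M(1) car by blast
      have "(A *\<^sub>v l) \<bullet> v = l \<bullet> (M *\<^sub>v v)" if "v \<in> carrier_vec 3" for v
        unfolding M(2) using transpose_vec_mult_scalar[OF Mc that l] .
      then have "(A *\<^sub>v l) \<bullet> x = 0" "(A *\<^sub>v l) \<bullet> y = 0"
        using xc yc l_F inv[OF M(1)] x(1) y(1) by simp_all
      moreover have "A *\<^sub>v l \<in> carrier_vec 3"
        using Mc l by (simp add: M(2))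
      ultimately show ?thesis
        using l_char by blast
    qed
    ultimately show ?thesis
      using trivial_spectrum_common_eigenvector[OF trivial_spectrum_subspace_transpose[OF ts] l]
      by blast
  qed
qed

section \<open>Passing to the quotient by a null vector\<close>

text \<open>When the first basis vector is annihilated, every matrix of the space has a zero first column, and
  its lower right corner inherits the trivial spectrum. The corners form the space \<open>\<W>\<close> induced on
  the quotient by that basis vector.\<close>

lemma trivial_spectrum_quotient_by_kernel_vector:
  fixes \<V> :: "'a::field mat set"
  assumes ts: "trivial_spectrum_subspace (1 + p) \<V>"
    and ker: "\<And>M. M \<in> \<V> \<Longrightarrow> M *\<^sub>v unit_vec (1 + p) 0 = 0\<^sub>v (1 + p)"
  obtains \<W> where "trivial_spectrum_subspace p \<W>" "\<V> \<subseteq> mat_space_join 1 p {0\<^sub>m 1 1} \<W>"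
proof -
  define corner where "corner M = mat p p (\<lambda>(i, j). M $$ (1 + i, 1 + j))" for M :: "'a mat"
  define top where "top M = mat 1 p (\<lambda>(i, j). M $$ (0, 1 + j))" for M :: "'a mat"
  have V: "\<V> \<subseteq> carrier_mat (1 + p) (1 + p)" "0\<^sub>m (1 + p) (1 + p) \<in> \<V>"
    "\<And>A B. A \<in> \<V> \<Longrightarrow> B \<in> \<V> \<Longrightarrow> A + B \<in> \<V>" "\<And>c A. A \<in> \<V> \<Longrightarrow> c \<cdot>\<^sub>m A \<in> \<V>"
    using ts by (auto simp: trivial_spectrum_subspace_def mat_subspace_iff)
  have block_carrier: "corner M \<in> carrier_mat p p" "top M \<in> carrier_mat 1 p" for M
    by (simp_all add: corner_def top_def)
  have block: "M = four_block_mat (0\<^sub>m 1 1) (top M) (0\<^sub>m p 1) (corner M)" if M: "M \<in> \<V>" for M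
  proof -
    have Mc: "M \<in> carrier_mat (1 + p) (1 + p)"
      using V(1) M by blast
    have "M $$ (i, 0) = 0" if "i < 1 + p" for i
    proof -
      have "M $$ (i, 0) = (M *\<^sub>v unit_vec (1 + p) 0) $ i"
        using Mc that by simp
      then show ?thesis
        using ker[OF M] that by simp
    qed
    then show ?thesis
      using Mc by (intro eq_matI) (auto simp: corner_def top_def)
  qed
  have "mat_subspace p (corner ` \<V>)"
    unfolding mat_subspace_iff
  proof (intro conjI ballI allI)
    have "corner (0\<^sub>m (1 + p) (1 + p)) = 0\<^sub>m p p"
      by (intro eq_matI) (auto simp: corner_def)
    then show "0\<^sub>m p p \<in> corner ` \<V>"
      using V(2) by (metis imageI)
  next
    fix A B assume "A \<in> corner ` \<V>" "B \<in> corner ` \<V>"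
    then obtain M N where MN: "M \<in> \<V>" "N \<in> \<V>" "A = corner M" "B = corner N"
      by blast
    then have "M \<in> carrier_mat (1 + p) (1 + p)" "N \<in> carrier_mat (1 + p) (1 + p)"
      using V(1) by auto
    then have "A + B = corner (M + N)"
      unfolding MN by (intro eq_matI) (auto simp: corner_def)
    then show "A + B \<in> corner ` \<V>"
      using V(3)[OF MN(1,2)] by blast
  next
    fix c A assume "A \<in> corner ` \<V>"
    then obtain M where M: "M \<in> \<V>" "A = corner M"
      by blast
    then have "M \<in> carrier_mat (1 + p) (1 + p)"
      using V(1) by auto
    then have "c \<cdot>\<^sub>m A = corner (c \<cdot>\<^sub>m M)"
      unfolding M by (intro eq_matI) (auto simp: corner_def)
    then show "c \<cdot>\<^sub>m A \<in> corner ` \<V>"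
      using V(4)[OF M(1)] by blast
  qed (use block_carrier(1) in blast)
  moreover have "\<not> eigenvalue (corner M) k" if M: "M \<in> \<V>" "k \<noteq> 0" for M k
  proof
    assume "eigenvalue (corner M) k"
    then have "eigenvalue (four_block_mat (0\<^sub>m 1 1) (top M) (0\<^sub>m p 1) (corner M)) k"
      using eigenvalue_four_block_upper[OF zero_carrier_mat block_carrier(2,1)] by blast
    then show False
      using block[OF M(1)] ts M by (auto simp: trivial_spectrum_subspace_def)
  qed
  ultimately have "trivial_spectrum_subspace p (corner ` \<V>)"
    by (auto simp: trivial_spectrum_subspace_def)
  moreover have "\<V> \<subseteq> mat_space_join 1 p {0\<^sub>m 1 1} (corner ` \<V>)"
  proof
    fix M assume M: "M \<in> \<V>"
    have "four_block_mat (0\<^sub>m 1 1) (top M) (0\<^sub>m p 1) (corner M) \<in>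
        mat_space_join 1 p {0\<^sub>m 1 1} (corner ` \<V>)"
      using M block_carrier by (intro mat_space_joinI) blast+
    then show "M \<in> mat_space_join 1 p {0\<^sub>m 1 1} (corner ` \<V>)"
      using block[OF M] by simp
  qed
  ultimately show ?thesis
    using that by blast
qed

section \<open>Matrices of size two over the field with two elements\<close>

lemma mat_2_eq_iff:
  assumes "A \<in> carrier_mat 2 2" "B \<in> carrier_mat 2 2"
  shows "A = B \<longleftrightarrow> A $$ (0, 0) = B $$ (0, 0) \<and> A $$ (0, 1) = B $$ (0, 1) \<and>
    A $$ (1, 0) = B $$ (1, 0) \<and> A $$ (1, 1) = B $$ (1, 1)"
  using assms by (auto intro!: eq_matI simp: less_2_cases_iff)

lemma index_mult_mat_2:
  fixes A B :: "'a::semiring_0 mat"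
  assumes "A \<in> carrier_mat 2 2" "B \<in> carrier_mat 2 2" "i < 2" "j < 2"
  shows "(A * B) $$ (i, j) = A $$ (i, 0) * B $$ (0, j) + A $$ (i, 1) * B $$ (1, j)"
  using assms by (simp add: scalar_prod_def numeral_2_eq_2)

lemma vec_2_eq_iff:
  assumes "v \<in> carrier_vec 2" "w \<in> carrier_vec 2"
  shows "v = w \<longleftrightarrow> v $ 0 = w $ 0 \<and> v $ 1 = w $ 1"
  using assms by (auto intro!: eq_vecI simp: less_2_cases_iff)

lemma index_mult_mat_vec_2:
  fixes A :: "'a::semiring_0 mat"
  assumes "A \<in> carrier_mat 2 2" "v \<in> carrier_vec 2" "i < 2"
  shows "(A *\<^sub>v v) $ i = A $$ (i, 0) * v $ 0 + A $$ (i, 1) * v $ 1"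
  using assms by (simp add: scalar_prod_def numeral_2_eq_2)

lemma ex_bit_iff: "(\<exists>x::bit. P x) \<longleftrightarrow> P 0 \<or> P 1"
  by (metis bit_not_zero_iff)

text \<open>None of the three nonzero vectors of the plane is fixed. Equivalently, the determinant of
  \<open>K + 1\<close> is 1, which says that trace and determinant of \<open>K\<close> agree.\<close>

lemma not_eigenvalue_one_bit_2_iff:
  fixes K :: "bit mat"
  assumes K: "K \<in> carrier_mat 2 2"
  shows "\<not> eigenvalue K 1 \<longleftrightarrow>
    (if K $$ (0, 1) = 1 \<and> K $$ (1, 0) = 1 then K $$ (0, 0) = 1 \<or> K $$ (1, 1) = 1
     else K $$ (0, 0) = 0 \<and> K $$ (1, 1) = 0)"
proof -
  let ?fix = "\<lambda>p q. K $$ (0, 0) * p + K $$ (0, 1) * q = p \<and> K $$ (1, 0) * p + K $$ (1, 1) * q = q"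
  have "eigenvector K v 1 \<longleftrightarrow> (v $ 0, v $ 1) \<noteq> (0, 0) \<and> ?fix (v $ 0) (v $ 1)"
    if v: "v \<in> carrier_vec 2" for v
  proof -
    have "K *\<^sub>v v \<in> carrier_vec 2"
      using K v by simp
    then show ?thesis
      using K v vec_2_eq_iff[of "K *\<^sub>v v" v] vec_2_eq_iff[OF v zero_carrier_vec]
        index_mult_mat_vec_2[OF K v, of 0] index_mult_mat_vec_2[OF K v, of 1]
      by (simp add: eigenvector_def)
  qed
  moreover have "v \<in> carrier_vec 2" if "eigenvector K v 1" for v
    using that K by (simp add: eigenvector_def)
  ultimately have "eigenvalue K 1 \<longleftrightarrow> (\<exists>v \<in> carrier_vec 2. (v $ 0, v $ 1) \<noteq> (0, 0) \<and> ?fix (v $ 0) (v $ 1))"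
    unfolding eigenvalue_def by blast
  also have "\<dots> \<longleftrightarrow> (\<exists>p q. (p, q) \<noteq> (0, 0) \<and> ?fix p q)"
  proof
    assume "\<exists>p q. (p, q) \<noteq> (0, 0) \<and> ?fix p q"
    then obtain p q where "(p, q) \<noteq> (0, 0) \<and> ?fix p q"
      by blast
    then show "\<exists>v \<in> carrier_vec 2. (v $ 0, v $ 1) \<noteq> (0, 0) \<and> ?fix (v $ 0) (v $ 1)"
      by (intro bexI[of _ "vec 2 (\<lambda>i. if i = 0 then p else q)"]) auto
  qed blast
  also have "\<dots> \<longleftrightarrow> ?fix 1 0 \<or> ?fix 0 1 \<or> ?fix 1 1"
    unfolding ex_bit_iff by (simp add: disj_ac)
  finally have "eigenvalue K 1 \<longleftrightarrow> ?fix 1 0 \<or> ?fix 0 1 \<or> ?fix 1 1" .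
  then show ?thesis
    by (cases "K $$ (0, 0)"; cases "K $$ (0, 1)"; cases "K $$ (1, 0)"; cases "K $$ (1, 1)") simp_all
qed

text \<open>A matrix without eigenvalue 1 whose off-diagonal entries are not both 1 has zero diagonal; in
  particular it vanishes if both off-diagonal entries do. Thus distinct elements of the space have
  distinct off-diagonal pairs. If \<open>K\<close> and \<open>L\<close> were nonzero and distinct, then \<open>K\<close>, \<open>L\<close>, \<open>K + L\<close> would
  realise the pairs \<open>(1, 0)\<close>, \<open>(0, 1)\<close>, \<open>(1, 1)\<close> in some order. The two with a zero entry off the
  diagonal have zero diagonal, hence so has the third, their sum; but that matrix fixes \<open>(1, 1)\<close>.\<close>

lemma trivial_spectrum_bit_2_eq:
  fixes \<W> :: "bit mat set"
  assumes ts: "trivial_spectrum_subspace 2 \<W>" and K: "K \<in> \<W>" "K \<noteq> 0\<^sub>m 2 2"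
  shows "\<W> = {0\<^sub>m 2 2, K}"
proof -
  have W: "\<W> \<subseteq> carrier_mat 2 2" "0\<^sub>m 2 2 \<in> \<W>" "\<And>A B. A \<in> \<W> \<Longrightarrow> B \<in> \<W> \<Longrightarrow> A + B \<in> \<W>"
    and ev: "\<And>M. M \<in> \<W> \<Longrightarrow> \<not> eigenvalue M 1"
    using ts by (auto simp: trivial_spectrum_subspace_def mat_subspace_iff)
  have "L = 0\<^sub>m 2 2 \<or> L = K" if L: "L \<in> \<W>" for L
  proof -
    have car: "K \<in> carrier_mat 2 2" "L \<in> carrier_mat 2 2"
      using K(1) L W(1) by auto
    have K_ne: "\<not> (K $$ (0, 0) = 0 \<and> K $$ (0, 1) = 0 \<and> K $$ (1, 0) = 0 \<and> K $$ (1, 1) = 0)"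
      using K(2) mat_2_eq_iff[OF car(1) zero_carrier_mat] by simp
    obtain a b c d where K_entries:
      "K $$ (0, 0) = a" "K $$ (0, 1) = b" "K $$ (1, 0) = c" "K $$ (1, 1) = d"
      by blast
    obtain e f g h where L_entries:
      "L $$ (0, 0) = e" "L $$ (0, 1) = f" "L $$ (1, 0) = g" "L $$ (1, 1) = h"
      by blast
    have sum_entries: "(K + L) $$ (0, 0) = a + e" "(K + L) $$ (0, 1) = b + f"
      "(K + L) $$ (1, 0) = c + g" "(K + L) $$ (1, 1) = d + h"
      using car K_entries L_entries by simp_all
    note no_ev = ev[OF K(1)] ev[OF L] ev[OF W(3)[OF K(1) L]]
    have "(e = 0 \<and> f = 0 \<and> g = 0 \<and> h = 0) \<or> (e = a \<and> f = b \<and> g = c \<and> h = d)"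
      using K_ne no_ev[unfolded not_eigenvalue_one_bit_2_iff[OF car(1)]
          not_eigenvalue_one_bit_2_iff[OF car(2)]
          not_eigenvalue_one_bit_2_iff[OF add_carrier_mat[OF car(2)]]]
      unfolding K_entries L_entries sum_entries
      by (cases b; cases c; cases f; cases g) auto
    then show ?thesis
      by (simp add: mat_2_eq_iff[OF car(2) zero_carrier_mat] mat_2_eq_iff[OF car(2,1)]
          K_entries[unfolded One_nat_def] L_entries[unfolded One_nat_def])
  qed
  then show ?thesis
    using K(1) W(2) by blast
qed

text \<open>The companion matrix of \<open>X\<^sup>2 + t X + t\<close>. These are the two monic quadratic polynomials over \<open>F\<^sub>2\<close>
  without the root 1.\<close>

definition companion_mat :: "bit \<Rightarrow> bit mat" where
  "companion_mat t = mat 2 2 (\<lambda>(i, j). if i = 0 then of_bool (j = 1) else t)"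

lemma companion_mat_carrier [simp]: "companion_mat t \<in> carrier_mat 2 2"
  by (simp add: companion_mat_def)

lemma companion_mat_one: "companion_mat 1 = C_mat"
  by (subst mat_2_eq_iff) (auto simp: companion_mat_def C_mat_def mat_of_rows_list_def)

text \<open>By the equality of trace and determinant, the characteristic polynomial of \<open>K\<close> is
  \<open>X\<^sup>2 + t X + t\<close> with \<open>t\<close> the trace. The rows of \<open>P\<close> are \<open>v\<close> and \<open>v K\<close> for a cyclic row vector \<open>v\<close>,
  so that \<open>P * K = companion_mat t * P\<close> by the Cayley-Hamilton theorem.\<close>

lemma similar_companion_mat:
  fixes K :: "bit mat"
  assumes K: "K \<in> carrier_mat 2 2" "K \<noteq> 0\<^sub>m 2 2" "\<not> eigenvalue K 1"
  shows "similar_mat_spaces 2 {0\<^sub>m 2 2, K} {0\<^sub>m 2 2, companion_mat (K $$ (0, 0) + K $$ (1, 1))}"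
proof -
  let ?t = "K $$ (0, 0) + K $$ (1, 1)"
  have entries: "\<not> (K $$ (0, 0) = 0 \<and> K $$ (0, 1) = 0 \<and> K $$ (1, 0) = 0 \<and> K $$ (1, 1) = 0)"
    using K(2) mat_2_eq_iff[OF K(1) zero_carrier_mat] by simp
  \<comment> \<open>Here \<open>v\<close> is the first unit vector if \<open>K\<close> has upper right entry 1, and the second one otherwise; in
    both cases \<open>P\<close> is its own inverse.\<close>
  define P :: "bit mat" where "P = mat 2 2 (\<lambda>(i, j).
    if K $$ (0, 1) = 1 then (if i = j then 1 else if i = 1 then K $$ (0, 0) else 0)
    else of_bool (i \<noteq> j))"
  have P: "P \<in> carrier_mat 2 2"
    by (simp add: P_def)
  have P_entries: "P $$ (0, 0) = K $$ (0, 1)" "P $$ (0, 1) = K $$ (0, 1) + 1"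
    "P $$ (1, 0) = (if K $$ (0, 1) = 1 then K $$ (0, 0) else 1)" "P $$ (1, 1) = K $$ (0, 1)"
    by (auto simp: P_def)
  have PP: "P * P = 1\<^sub>m 2"
    unfolding mat_2_eq_iff[OF mult_carrier_mat[OF P P] one_carrier_mat]
    by (simp add: index_mult_mat_2[OF P P] P_entries[unfolded One_nat_def])
  obtain a b c d where K_entries:
    "K $$ (0, 0) = a" "K $$ (0, 1) = b" "K $$ (1, 0) = c" "K $$ (1, 1) = d"
    by blast
  \<comment> \<open>The second alternative solves the equality of trace and determinant for \<open>c\<close>.\<close>
  have shape: "b = 0 \<and> a = 0 \<and> d = 0 \<and> c = 1 \<or> b = 1 \<and> c = a * d + a + d"
    using entries K(3)[unfolded not_eigenvalue_one_bit_2_iff[OF K(1)]] unfolding K_entries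
    by (cases a; cases b; cases c; cases d) simp_all
  have "P * K * P = companion_mat ?t"
    unfolding mat_2_eq_iff[OF mult_carrier_mat[OF mult_carrier_mat[OF P K(1)] P]
        companion_mat_carrier]
    using shape
    by (cases a; cases d) (auto simp: index_mult_mat_2[OF mult_carrier_mat[OF P K(1)] P]
        index_mult_mat_2[OF P K(1)] P_entries[unfolded One_nat_def]
        K_entries[unfolded One_nat_def] companion_mat_def
        simp del: assoc_mult_mat index_mult_mat)
  then show ?thesis
    using P PP by (intro similar_mat_spacesI[of P 2 P])
      (auto simp del: assoc_mult_mat simp add: right_mult_zero_mat[OF P] left_mult_zero_mat[OF P])
qed

lemma trivial_spectrum_zero: "trivial_spectrum_subspace n {0\<^sub>m n n :: 'a::field mat}"
proof -
  have "\<not> eigenvalue (0\<^sub>m n n :: 'a mat) k" if "k \<noteq> 0" for k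
  proof
    assume "eigenvalue (0\<^sub>m n n :: 'a mat) k"
    then obtain v :: "'a vec" where v: "v \<in> carrier_vec n" "v \<noteq> 0\<^sub>v n" "0\<^sub>m n n *\<^sub>v v = k \<cdot>\<^sub>v v"
      by (auto simp: eigenvalue_def eigenvector_def)
    have "v $ i = 0" if "i < n" for i
      using arg_cong[OF v(3), of "\<lambda>w. w $ i"] v(1) that \<open>k \<noteq> 0\<close> by simp
    then show False
      using v(1,2) by (auto intro: eq_vecI)
  qed
  then show ?thesis
    by (auto simp: trivial_spectrum_subspace_def mat_subspace_iff)
qed

lemma trivial_spectrum_companion_mat: "trivial_spectrum_subspace 2 {0\<^sub>m 2 2, companion_mat t}"
proof -
  let ?W = "{0\<^sub>m 2 2, companion_mat t}"
  have "companion_mat t + companion_mat t = 0\<^sub>m 2 2"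
    by (intro eq_matI) (auto simp: companion_mat_def)
  moreover have "c \<cdot>\<^sub>m A = 0\<^sub>m 2 2 \<or> c \<cdot>\<^sub>m A = A" if "A \<in> carrier_mat 2 2" for c :: bit and A
  proof (cases "c = 0")
    case True
    then show ?thesis
      using that by (intro disjI1 eq_matI) auto
  next
    case False
    then show ?thesis
      using that by (intro disjI2 eq_matI) auto
  qed
  ultimately have "mat_subspace 2 ?W"
    by (auto simp: mat_subspace_iff)
  moreover have "\<not> eigenvalue (companion_mat t) 1"
    by (subst not_eigenvalue_one_bit_2_iff) (auto simp: companion_mat_def)
  moreover have "\<not> eigenvalue (0\<^sub>m 2 2 :: bit mat) 1"
    by (subst not_eigenvalue_one_bit_2_iff) auto
  ultimately show ?thesis
    by (auto simp: trivial_spectrum_subspace_def)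
qed

section \<open>The reducible spaces of dimension three\<close>

lemma one_plus_two: "1 + 2 = (3::nat)" "2 + 1 = (3::nat)"
  by simp_all

lemma mat_span_C_mat: "mat_span 2 {C_mat} = {0\<^sub>m 2 2, companion_mat 1}"
proof -
  have "0 \<cdot>\<^sub>m companion_mat 1 = 0\<^sub>m 2 2" "1 \<cdot>\<^sub>m companion_mat 1 = companion_mat 1"
    by (auto intro!: eq_matI simp: companion_mat_def)
  then show ?thesis
    unfolding companion_mat_one[symmetric]
    by (simp add: mat_span_singleton UNIV_bit)
qed

lemma mat_3_eqI:
  assumes "A \<in> carrier_mat 3 3" "B \<in> carrier_mat 3 3"
    and "\<And>i j. i \<in> {0, 1, 2} \<Longrightarrow> j \<in> {0, 1, 2} \<Longrightarrow> A $$ (i, j) = B $$ (i, j)"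
  shows "A = B"
proof (rule eq_matI)
  have less_3: "k < 3 \<Longrightarrow> k \<in> {0, 1, 2}" for k :: nat
    by auto
  fix i j assume "i < dim_row B" "j < dim_col B"
  then show "A $$ (i, j) = B $$ (i, j)"
    using assms less_3 by auto
qed (use assms in auto)

lemma strict_upper_triangular_mats_3_iff:
  "M \<in> strict_upper_triangular_mats 3 \<longleftrightarrow> M \<in> carrier_mat 3 3 \<and>
     M $$ (0, 0) = 0 \<and> M $$ (1, 0) = 0 \<and> M $$ (1, 1) = 0 \<and>
     M $$ (2, 0) = 0 \<and> M $$ (2, 1) = 0 \<and> M $$ (2, 2) = 0"
proof -
  have "(\<forall>i<3. P i) \<longleftrightarrow> P 0 \<and> P 1 \<and> P (2::nat)" for P
    by (auto simp: numeral_3_eq_3 numeral_2_eq_2 less_Suc_eq)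
  moreover have "(\<forall>j\<le>2. P j) \<longleftrightarrow> P 0 \<and> P 1 \<and> P (2::nat)"
    "(\<forall>j\<le>1. P j) \<longleftrightarrow> P 0 \<and> P (1::nat)" for P
    by (auto simp: numeral_2_eq_2 le_Suc_eq)
  ultimately show ?thesis
    by (simp add: strict_upper_triangular_mats_def)
qed

text \<open>The space of nilpotent 2 by 2 matrices spanned by \<open>companion_mat 0\<close> may be placed in either corner.
  Having both descriptions makes the space comparable with its own transpose.\<close>

lemma strict_upper_triangular_mats_3_eq_joins:
  "strict_upper_triangular_mats 3 = mat_space_join 1 2 {0\<^sub>m 1 1} {0\<^sub>m 2 2, companion_mat 0}"
  "strict_upper_triangular_mats 3 = mat_space_join 2 1 {0\<^sub>m 2 2, companion_mat 0} {0\<^sub>m 1 1}"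
proof -
  let ?O = "{0\<^sub>m 1 1} :: bit mat set" and ?N = "{0\<^sub>m 2 2, companion_mat 0}"
  have car: "mat_space_join 1 2 ?O ?N \<subseteq> carrier_mat 3 3" "mat_space_join 2 1 ?N ?O \<subseteq> carrier_mat 3 3"
    using mat_space_join_carrier[of ?O 1 ?N 2, unfolded one_plus_two]
      mat_space_join_carrier[of ?N 2 ?O 1, unfolded one_plus_two] by simp_all
  have "M \<in> mat_space_join 1 2 ?O ?N \<and> M \<in> mat_space_join 2 1 ?N ?O"
    if M: "M \<in> strict_upper_triangular_mats 3" for M
  proof
    note M' = M[unfolded strict_upper_triangular_mats_3_iff]
    let ?J = "four_block_mat (0\<^sub>m 1 1) (mat 1 2 (\<lambda>(i, j). M $$ (0, 1 + j))) (0\<^sub>m 2 1)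
      (if M $$ (1, 2) = 0 then 0\<^sub>m 2 2 else companion_mat 0)"
    have J: "?J \<in> mat_space_join 1 2 ?O ?N"
      by (intro mat_space_joinI) auto
    have "?J = M"
      using M' J car(1) by (intro mat_3_eqI) (auto simp: companion_mat_def numeral_2_eq_2)
    then show "M \<in> mat_space_join 1 2 ?O ?N"
      using J by simp
    let ?L = "four_block_mat (if M $$ (0, 1) = 0 then 0\<^sub>m 2 2 else companion_mat 0)
      (mat 2 1 (\<lambda>(i, j). M $$ (i, 2))) (0\<^sub>m 1 2) (0\<^sub>m 1 1)"
    have L: "?L \<in> mat_space_join 2 1 ?N ?O"
      by (intro mat_space_joinI) auto
    have "?L = M"
      using M' L car(2) by (intro mat_3_eqI) (auto simp: companion_mat_def numeral_2_eq_2)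
    then show "M \<in> mat_space_join 2 1 ?N ?O"
      using L by simp
  qed
  moreover have "M \<in> strict_upper_triangular_mats 3" if "M \<in> mat_space_join 1 2 ?O ?N" for M
    using that car(1) unfolding strict_upper_triangular_mats_3_iff
    by (elim mat_space_joinE) (auto simp: companion_mat_def numeral_2_eq_2)
  moreover have "M \<in> strict_upper_triangular_mats 3" if "M \<in> mat_space_join 2 1 ?N ?O" for M
    using that car(2) unfolding strict_upper_triangular_mats_3_iff
    by (elim mat_space_joinE) (auto simp: companion_mat_def numeral_2_eq_2)
  ultimately show "strict_upper_triangular_mats 3 = mat_space_join 1 2 ?O ?N"
    "strict_upper_triangular_mats 3 = mat_space_join 2 1 ?N ?O"
    by blast+
qed

text \<open>Move the joint null vector to the first basis vector. The space then lies in \<open>{0} \<or> \<K>\<close>, where \<open>\<K>\<close>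
  is the space of lower right corners. The upper right block ranges over four row vectors, so 8
  elements force \<open>\<K>\<close> to be nonzero; a nonzero \<open>\<K>\<close> has just two elements, the join then has 8 as well,
  and the inclusion is an equality.\<close>

lemma common_kernel_vector_classification:
  fixes \<V> :: "bit mat set"
  assumes ts: "trivial_spectrum_subspace 3 \<V>" and card: "card \<V> = 8"
    and ker: "has_common_kernel_vector 3 \<V>"
  obtains t where
    "similar_mat_spaces 3 \<V> (mat_space_join 1 2 {0\<^sub>m 1 1} {0\<^sub>m 2 2, companion_mat t})"
proof -
  have V: "\<V> \<subseteq> carrier_mat 3 3"
    using ts by (auto simp: trivial_spectrum_subspace_def mat_subspace_iff)
  obtain x where x: "x \<in> carrier_vec 3" "x \<noteq> 0\<^sub>v 3" "\<And>M. M \<in> \<V> \<Longrightarrow> M *\<^sub>v x = 0\<^sub>v 3"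
    using ker unfolding has_common_kernel_vector_def by blast
  obtain P Q where PQ: "P \<in> carrier_mat 3 3" "Q \<in> carrier_mat 3 3" "P * Q = 1\<^sub>m 3"
    "Q * P = 1\<^sub>m 3" and Px: "P *\<^sub>v unit_vec 3 0 = x"
    using obtain_invertible_with_first_column[OF x(1,2)] by blast
  define \<W> where "\<W> = (\<lambda>M. Q * M * P) ` \<V>"
  have VW: "similar_mat_spaces 3 \<V> \<W>"
    unfolding \<W>_def by (rule similar_mat_spacesI[OF PQ(2,1,4,3) refl])
  have W_ts: "trivial_spectrum_subspace 3 \<W>" and W_card: "card \<W> = 8"
    using similar_mat_spaces_trivial_spectrum[OF VW ts] similar_mat_spaces_card[OF VW V] card
    by simp_all
  have "Q *\<^sub>v x = (Q * P) *\<^sub>v unit_vec 3 0"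
    unfolding Px[symmetric] using PQ(1,2) by (intro assoc_mult_mat_vec[symmetric]) auto
  then have Qx: "Q *\<^sub>v x = unit_vec 3 0"
    using PQ(4) by simp
  have W_ker: "N *\<^sub>v unit_vec 3 0 = 0\<^sub>v 3" if N: "N \<in> \<W>" for N
  proof -
    obtain M where M: "M \<in> \<V>" "N = Q * M * P"
      using N unfolding \<W>_def by blast
    then have "N *\<^sub>v (Q *\<^sub>v x) = Q *\<^sub>v 0\<^sub>v 3"
      using conj_mat_mult_vec[OF PQ(2,1,3) _ x(1), of M] V x(3) by auto
    also have "\<dots> = 0\<^sub>v 3"
      using PQ(2) by (intro eq_vecI) auto
    finally show ?thesis
      by (simp only: Qx)
  qed
  obtain \<K> where K_ts: "trivial_spectrum_subspace 2 \<K>"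
    and W_sub: "\<W> \<subseteq> mat_space_join 1 2 {0\<^sub>m 1 1} \<K>"
    by (rule trivial_spectrum_quotient_by_kernel_vector[of 2 \<W>, unfolded one_plus_two, OF W_ts W_ker])
  have K: "\<K> \<subseteq> carrier_mat 2 2" "0\<^sub>m 2 2 \<in> \<K>"
    using K_ts by (auto simp: trivial_spectrum_subspace_def mat_subspace_iff)
  have card_join: "card (mat_space_join 1 2 {0\<^sub>m 1 1} \<K>) = 4 * card \<K>"
    using card_mat_space_join[of "{0\<^sub>m 1 1}" 1 \<K> 2] K(1)
      finite_card_carrier_mat(2)[OF finite_UNIV_bit, of 1 2]
    by (simp add: card_UNIV_bit)
  have fin: "finite (mat_space_join 1 2 {0\<^sub>m 1 1} \<K>)"
    using mat_space_join_carrier[of "{0\<^sub>m 1 1}" 1 \<K> 2] K(1)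
      finite_card_carrier_mat(1)[OF finite_UNIV_bit]
    by (auto intro: finite_subset)
  have "\<K> \<noteq> {0\<^sub>m 2 2}"
  proof
    assume "\<K> = {0\<^sub>m 2 2}"
    then show False
      using card_mono[OF fin W_sub] W_card card_join by simp
  qed
  then obtain K where K0: "K \<in> \<K>" "K \<noteq> 0\<^sub>m 2 2"
    using K(2) by blast
  have K_eq: "\<K> = {0\<^sub>m 2 2, K}"
    by (rule trivial_spectrum_bit_2_eq[OF K_ts K0])
  have "card \<K> = 2"
    using K0(2) by (simp add: K_eq)
  then have W_eq: "\<W> = mat_space_join 1 2 {0\<^sub>m 1 1} \<K>"
    using card_subset_eq[OF fin W_sub] W_card card_join by simp
  have "K \<in> carrier_mat 2 2" "\<not> eigenvalue K 1"
    using K0(1) K(1) K_ts by (auto simp: trivial_spectrum_subspace_def)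
  then have "similar_mat_spaces 2 \<K> {0\<^sub>m 2 2, companion_mat (K $$ (0, 0) + K $$ (1, 1))}"
    unfolding K_eq using similar_companion_mat K0(2) by blast
  then have "similar_mat_spaces 3 \<W> (mat_space_join 1 2 {0\<^sub>m 1 1}
      {0\<^sub>m 2 2, companion_mat (K $$ (0, 0) + K $$ (1, 1))})"
    unfolding W_eq
    using similar_mat_spaces_join[of 1 "{0\<^sub>m 1 1}" "{0\<^sub>m 1 1}" 2 \<K>, unfolded one_plus_two] K(1)
    by (simp add: similar_mat_spaces_refl)
  then show ?thesis
    using that similar_mat_spaces_trans[OF VW _ V] by blast
qed

theorem proposition5p3:
  fixes reducible_ts3 :: "bit mat set \<Rightarrow> bool"
    and \<V>1 \<V>2 \<V>3 :: "bit mat set"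
  defines "reducible_ts3 \<equiv> (\<lambda>\<V>. trivial_spectrum_subspace 3 \<V> \<and>
             \<not> irreducible_mat_space 3 \<V> \<and> mat_subspace_dim 3 \<V> = 3)"
    and "\<V>1 \<equiv> mat_space_join 2 1 (mat_span 2 {C_mat}) {0\<^sub>m 1 1}"
    and "\<V>2 \<equiv> mat_space_join 1 2 {0\<^sub>m 1 1} (mat_span 2 {C_mat})"
    and "\<V>3 \<equiv> strict_upper_triangular_mats 3"
  shows "reducible_ts3 \<V>1 \<and> reducible_ts3 \<V>2 \<and> reducible_ts3 \<V>3 \<and>
         \<not> similar_mat_spaces 3 \<V>1 \<V>2 \<and>
         \<not> similar_mat_spaces 3 \<V>1 \<V>3 \<and>
         \<not> similar_mat_spaces 3 \<V>2 \<V>3 \<and>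
         (\<forall>\<V>. reducible_ts3 \<V> \<longrightarrow>
            similar_mat_spaces 3 \<V> \<V>1 \<or> similar_mat_spaces 3 \<V> \<V>2 \<or> similar_mat_spaces 3 \<V> \<V>3)"
proof -
  define \<C> where "\<C> t = {0\<^sub>m 2 2, companion_mat t}" for t
  let ?O = "{0\<^sub>m 1 1} :: bit mat set"
  have V1: "\<V>1 = mat_space_join 2 1 (\<C> 1) ?O" and V2: "\<V>2 = mat_space_join 1 2 ?O (\<C> 1)"
    and V3: "\<V>3 = mat_space_join 1 2 ?O (\<C> 0)" "\<V>3 = mat_space_join 2 1 (\<C> 0) ?O"
    by (simp_all only: \<V>1_def \<V>2_def \<V>3_def \<C>_def mat_span_C_mat
        strict_upper_triangular_mats_3_eq_joins[symmetric])
  have O_car: "?O \<subseteq> carrier_mat 1 1" and C_car: "\<C> t \<subseteq> carrier_mat 2 2" for t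
    by (simp_all add: \<C>_def)
  have C_card: "card (\<C> t) = 2" for t
  proof -
    have "companion_mat t $$ (0, 1) \<noteq> 0\<^sub>m 2 2 $$ (0, 1)"
      by (simp add: companion_mat_def)
    then have "0\<^sub>m 2 2 \<noteq> companion_mat t"
      by metis
    then show ?thesis
      by (simp add: \<C>_def)
  qed
  have C_ts: "trivial_spectrum_subspace 2 (\<C> t)" for t
    unfolding \<C>_def by (rule trivial_spectrum_companion_mat)
  have O_ts: "trivial_spectrum_subspace 1 ?O"
    by (rule trivial_spectrum_zero)
  have dim_iff: "mat_subspace_dim 3 \<V> = 3 \<longleftrightarrow> card \<V> = 8"
    if "trivial_spectrum_subspace 3 \<V>" for \<V> :: "bit mat set"
  proof -
    have "card \<V> = 2 ^ mat_subspace_dim 3 \<V>"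
      using that by (intro card_eq_2_power_mat_subspace_dim) (simp add: trivial_spectrum_subspace_def)
    moreover have "(2::nat) ^ d = 8 \<longleftrightarrow> d = 3" for d
      using power_inject_exp[of "2::nat" d 3] by simp
    ultimately show ?thesis
      by simp
  qed
  \<comment> \<open>All three spaces are joins of a line of 2 by 2 matrices with the zero space.\<close>
  have red_C: "reducible_ts3 (mat_space_join 1 2 ?O (\<C> t))" "reducible_ts3 (mat_space_join 2 1 (\<C> t) ?O)"
    for t
  proof -
    have ts: "trivial_spectrum_subspace 3 (mat_space_join 1 2 ?O (\<C> t))"
      "trivial_spectrum_subspace 3 (mat_space_join 2 1 (\<C> t) ?O)"
      using trivial_spectrum_subspace_join[OF O_ts C_ts] trivial_spectrum_subspace_join[OF C_ts O_ts]
      by (simp_all only: one_plus_two)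
    moreover have "card (mat_space_join 1 2 ?O (\<C> t)) = 8" "card (mat_space_join 2 1 (\<C> t) ?O) = 8"
      unfolding card_mat_space_join[OF O_car C_car] card_mat_space_join[OF C_car O_car]
        finite_card_carrier_mat(2)[OF finite_UNIV_bit] C_card card_UNIV_bit
      by simp_all
    moreover have "\<not> irreducible_mat_space 3 (mat_space_join 1 2 ?O (\<C> t))"
      "\<not> irreducible_mat_space 3 (mat_space_join 2 1 (\<C> t) ?O)"
      using not_irreducible_join[OF O_car C_car] not_irreducible_join[OF C_car O_car]
      by (simp_all only: one_plus_two) simp_all
    ultimately show "reducible_ts3 (mat_space_join 1 2 ?O (\<C> t))"
      "reducible_ts3 (mat_space_join 2 1 (\<C> t) ?O)"
      by (simp_all add: reducible_ts3_def dim_iff)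
  qed
  have red: "reducible_ts3 \<V>1" "reducible_ts3 \<V>2" "reducible_ts3 \<V>3"
    using red_C by (simp_all only: V1 V2 V3(1))
  have car: "\<V> \<subseteq> carrier_mat 3 3" if "reducible_ts3 \<V>" for \<V>
    using that by (auto simp: reducible_ts3_def trivial_spectrum_subspace_def mat_subspace_iff)
  note car123 = red[THEN car]

  have O_transpose: "transpose_mat ` ?O = ?O"
    by simp
  have C1_transpose: "transpose_mat ` \<C> 1 = \<C> 1"
  proof -
    have "transpose_mat (companion_mat 1) = companion_mat 1"
      by (intro eq_matI) (auto simp: companion_mat_def)
    then show ?thesis
      by (simp add: \<C>_def)
  qed
  \<comment> \<open>Transposition exchanges the first two classes and fixes the third.\<close>
  have V1_V2: "similar_mat_spaces 3 (transpose_mat ` \<V>2) \<V>1"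
    using similar_mat_spaces_transpose_join[OF O_car C_car[of 1]]
    unfolding one_plus_two V1 V2 O_transpose C1_transpose .
  have V3_V3: "similar_mat_spaces 3 (transpose_mat ` \<V>3) \<V>3"
  proof -
    have "similar_mat_spaces 2 (transpose_mat ` \<C> 0) (\<C> 0)"
    proof -
      let ?T = "transpose_mat (companion_mat 0)"
      have "?T $$ (1, 0) \<noteq> 0\<^sub>m 2 2 $$ (1, 0)"
        by (simp add: companion_mat_def)
      then have "?T \<noteq> 0\<^sub>m 2 2"
        by metis
      moreover have "\<not> eigenvalue ?T 1"
        by (subst not_eigenvalue_one_bit_2_iff) (auto simp: companion_mat_def)
      ultimately have "similar_mat_spaces 2 {0\<^sub>m 2 2, ?T} {0\<^sub>m 2 2, companion_mat (?T $$ (0, 0) + ?T $$ (1, 1))}"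
        by (intro similar_companion_mat) auto
      moreover have "?T $$ (0, 0) + ?T $$ (1, 1) = 0"
        by (simp add: companion_mat_def)
      ultimately show ?thesis
        by (simp only: \<C>_def image_insert image_empty zero_transpose_mat)
    qed
    moreover have "transpose_mat ` \<C> 0 \<subseteq> carrier_mat 2 2"
      using C_car[of 0] by auto
    ultimately have "similar_mat_spaces 3 (mat_space_join 1 2 ?O (transpose_mat ` \<C> 0)) \<V>3"
      using similar_mat_spaces_join[OF similar_mat_spaces_refl[OF O_car] _ O_car]
      unfolding V3(1) one_plus_two[symmetric] by blast
    moreover have "similar_mat_spaces 3 (transpose_mat ` \<V>3) (mat_space_join 1 2 ?O (transpose_mat ` \<C> 0))"
      using similar_mat_spaces_transpose_join[OF C_car[of 0] O_car]
      unfolding one_plus_two V3(2) O_transpose .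
    moreover have "transpose_mat ` \<V>3 \<subseteq> carrier_mat 3 3"
      using car123(3) by auto
    ultimately show ?thesis
      using similar_mat_spaces_trans by blast
  qed

  \<comment> \<open>The first space has no joint null vector, whereas the other two have one. For the transposed spaces
    it is the second one that stands apart, and this separates it from the third.\<close>
  have ker: "has_common_kernel_vector 3 \<V>2" "has_common_kernel_vector 3 \<V>3"
    using has_common_kernel_vector_join_zero[OF C_car, of 1, unfolded one_plus_two]
    by (simp_all add: V2 V3(1))
  have no_ker: "\<not> has_common_kernel_vector 3 \<V>1"
  proof
    assume "has_common_kernel_vector 3 \<V>1"
    then have "has_common_kernel_vector 2 (\<C> 1)"
      unfolding V1 using O_car C_car
      by (intro has_common_kernel_vector_joinD[of 2 1 _ ?O, unfolded one_plus_two]) (auto simp: \<C>_def)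
    then obtain y :: "bit vec" where y: "y \<in> carrier_vec 2" "y \<noteq> 0\<^sub>v 2" "companion_mat 1 *\<^sub>v y = 0\<^sub>v 2"
      by (auto simp: has_common_kernel_vector_def \<C>_def)
    have "(companion_mat 1 *\<^sub>v y) $ 0 = y $ 1" "(companion_mat 1 *\<^sub>v y) $ 1 = y $ 0 + y $ 1"
      using index_mult_mat_vec_2[of "companion_mat 1" y 0] index_mult_mat_vec_2[of "companion_mat 1" y 1]
        y(1) companion_mat_carrier[of 1] by (simp_all add: companion_mat_def)
    then show False
      using y vec_2_eq_iff[OF y(1) zero_carrier_vec] by simp
  qed
  have not_12: "\<not> similar_mat_spaces 3 \<V>1 \<V>2" and not_13: "\<not> similar_mat_spaces 3 \<V>1 \<V>3"
    using no_ker ker similar_mat_spaces_sym[OF _ car123(1)]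
      similar_mat_spaces_common_kernel[OF _ car123(2), of \<V>1]
      similar_mat_spaces_common_kernel[OF _ car123(3), of \<V>1] by blast+
  have not_23: "\<not> similar_mat_spaces 3 \<V>2 \<V>3"
  proof
    assume "similar_mat_spaces 3 \<V>2 \<V>3"
    then have 1: "similar_mat_spaces 3 (transpose_mat ` \<V>2) (transpose_mat ` \<V>3)"
      by (rule similar_mat_spaces_transpose[OF _ car123(2)])
    have T2: "transpose_mat ` \<V>2 \<subseteq> carrier_mat 3 3"
      using car123(2) by auto
    have "similar_mat_spaces 3 \<V>1 (transpose_mat ` \<V>2)"
      by (rule similar_mat_spaces_sym[OF V1_V2 T2])
    moreover have "similar_mat_spaces 3 (transpose_mat ` \<V>2) \<V>3"
      by (rule similar_mat_spaces_trans[OF 1 V3_V3 T2])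
    ultimately have "similar_mat_spaces 3 \<V>1 \<V>3"
      using similar_mat_spaces_trans car123(1) by blast
    with not_13 show False ..
  qed

  have cases_ker: "similar_mat_spaces 3 \<V> \<V>2 \<or> similar_mat_spaces 3 \<V> \<V>3"
    if \<V>: "trivial_spectrum_subspace 3 \<V>" "card \<V> = 8" "has_common_kernel_vector 3 \<V>" for \<V>
  proof -
    obtain t where "similar_mat_spaces 3 \<V> (mat_space_join 1 2 ?O (\<C> t))"
      using common_kernel_vector_classification[OF \<V>] unfolding \<C>_def by blast
    then show ?thesis
      by (cases "t = 0") (simp_all add: V2 V3(1))
  qed
  have "similar_mat_spaces 3 \<V> \<V>1 \<or> similar_mat_spaces 3 \<V> \<V>2 \<or> similar_mat_spaces 3 \<V> \<V>3"
    if \<V>: "reducible_ts3 \<V>" for \<V>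
  proof -
    let ?T = "transpose_mat ` \<V>"
    have ts: "trivial_spectrum_subspace 3 \<V>" and V_card: "card \<V> = 8"
      using \<V> dim_iff by (auto simp: reducible_ts3_def)
    have TT: "transpose_mat ` ?T = \<V>"
      by (simp add: image_image)
    from \<V> ts consider "has_common_kernel_vector 3 \<V>" | "has_common_kernel_vector 3 ?T"
      using reducible_imp_common_kernel_vector by (auto simp: reducible_ts3_def)
    then show ?thesis
    proof cases
      case 1
      then show ?thesis
        using cases_ker[OF ts V_card] by blast
    next
      case 2
      have T_ts: "trivial_spectrum_subspace 3 ?T"
        by (rule trivial_spectrum_subspace_transpose[OF ts])
      have T_car: "?T \<subseteq> carrier_mat 3 3"
        using car[OF \<V>] by auto
      have "card ?T = 8"
        using V_card by (simp add: card_image inj_on_def)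
      then have "similar_mat_spaces 3 ?T \<V>2 \<or> similar_mat_spaces 3 ?T \<V>3"
        by (rule cases_ker[OF T_ts _ 2])
      then have "similar_mat_spaces 3 \<V> (transpose_mat ` \<V>2) \<or> similar_mat_spaces 3 \<V> (transpose_mat ` \<V>3)"
        using similar_mat_spaces_transpose[OF _ T_car] unfolding TT by blast
      then show ?thesis
        using similar_mat_spaces_trans[OF _ V1_V2 car[OF \<V>]]
          similar_mat_spaces_trans[OF _ V3_V3 car[OF \<V>]] by blast
    qed
  qed
  then show ?thesis
    using red not_12 not_13 not_23 by blast
qed

end
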